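(* There is a unique affine-isomorphism $\nu\in H_1^+(\kappa)\longleftrightarrow\tilde\nu\in H_1^+(\tilde\mu)_\beta$ with $$\dim_\beta(z)\,\tilde\nu(z,\gamma)=\dim(z)\,\nu(z)\,\gamma^\beta,\qquad (z,\gamma)\in\widetilde{\mathfrak{Z}}.$$
   Context: Setting. $A_0=\mathbb{C}1$, and $A_n$ ($n\ge1$) are atomic $W^*$-algebras with separable preduals, with unital normal embeddings $A_n\hookrightarrow A_{n+1}$ ($n\ge0$); $A=\varinjlim A_n$ ($C^*$-inductive limit). $\mathfrak{Z}_n$ is the (countable) set of minimal projections of the center $\mathcal{Z}(A_n)$, $\mathfrak{Z}=\bigsqcup_{n\ge0}\mathfrak{Z}_n$ (so $\mathfrak{Z}_0=\{1\}$), and $zA_n=B(\mathcal{H}_z)$ for $z\in\mathfrak{Z}_n$. It is assumed that $\dim(z):=\dim\mathcal{H}_z<\infty$ for all $z$. $\alpha:\mathbb{R}\curvearrowright A$ is a flow with $\alpha^t(A_n)=A_n$, whose restriction $\alpha_n^t$ to each $A_n$ is continuous in the $u$-topology ($t\mapsto\varphi\circ\alpha_n^t$ norm continuous for each $\varphi$ in the predual). Then $\alpha_n^t$ fixes $\mathcal{Z}(A_n)$ pointwise, and for each $z\in\mathfrak{Z}_n$ there is a unique positive invertible $\rho_z\in zA_n=B(\mathcal{H}_z)$ with $\alpha_n^t=\mathrm{Ad}\,\rho_z^{it}$ on $zA_n$ and $\mathrm{Tr}(\rho_z)=\mathrm{Tr}(\rho_z^{-1})$ ($\mathrm{Tr}$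 the non-normalized trace). $\beta\in\mathbb{R}$ is fixed. For $(z,z')\in\mathfrak{Z}_{n+1}\times\mathfrak{Z}_n$, $m(z,z')$ denotes the multiplicity of $z'A_n=B(\mathcal{H}_{z'})$ in $zA_{n+1}=B(\mathcal{H}_z)$ via $A_n\hookrightarrow A_{n+1}$; $m(z,z')>0$ iff $zz'\ne0$. Put $\dim_\beta(z)=\mathrm{Tr}(\rho_z^{-\beta})$ and define the link $$\kappa(z,z')=\frac{\mathrm{Tr}(\rho_z^{-\beta}z')}{\dim_\beta(z)},\qquad (z,z')\in\mathfrak{Z}_{n+1}\times\mathfrak{Z}_n,\ n\ge0,$$ where $\mathrm{Tr}(\rho_z^{-\beta}z')$ is computed in $zA_{n+1}=B(\mathcal{H}_z)$. $H_1^+(\kappa)$ is the set of normalized $\kappa$-harmonic functions: $\nu:\mathfrak{Z}\to[0,\infty)$ with $\nu(z')=\sum_{z\in\mathfrak{Z}_{n+1}}\nu(z)\kappa(z,z')$ for all $z'\in\mathfrak{Z}_n$, $n\ge0$, and $\nu(1)=1$. Weight-extended branching graph. $\Gamma$ is the countable subgroup of $(0,\infty)$ (multiplicative) generated by all eigenvalues of all $\rho_z$, $z\in\mathfrak{Z}$. $\rho_z=\sum_{\gamma\in\Gamma}\gamma\,p_z(\gamma)$ is the spectral decomposition ($p_z(\gamma)=0$ if $\gamma$ is not an eigenvalue). For $(z,z')\in\mathfrak{Z}_{n+1}\times\mathfrak{Z}_n$ with $m(z,z')>0$ and $\gamma\in\Gamma$, put $q_{(z,z')}(\gamma)=\sum_{\gamma'\in\Gamma}p_z(\gamma\gamma')p_{z'}(\gamma')$,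 a projection in $zA_{n+1}$ (note $\rho_z$ and $\rho_{z'}$ commute in $zA_{n+1}$). $\widetilde{\mathfrak{Z}}_n=\mathfrak{Z}_n\times\Gamma$, $\widetilde{\mathfrak{Z}}=\bigsqcup_{n\ge0}\widetilde{\mathfrak{Z}}_n$, and for $((z,\gamma),(z',\gamma'))\in\widetilde{\mathfrak{Z}}_{n+1}\times\widetilde{\mathfrak{Z}}_n$ $$\tilde\mu((z,\gamma),(z',\gamma'))=\frac{\mathrm{Tr}(q_{(z,z')}(\gamma^{-1}\gamma'))}{\dim(z)}\ \text{ if } m(z,z')>0,\qquad \tilde\mu((z,\gamma),(z',\gamma'))=0\ \text{ if } m(z,z')=0.$$ $H_1^+(\tilde\mu)_\beta$ is the set of normalized, $\beta$-power scaling $\tilde\mu$-harmonic functions: $\tilde\nu:\widetilde{\mathfrak{Z}}\to[0,+\infty)$ such that (i) $\tilde\nu(z',\gamma')=\sum_{(z,\gamma)\in\widetilde{\mathfrak{Z}}_{n+1}}\tilde\nu(z,\gamma)\tilde\mu((z,\gamma),(z',\gamma'))$ for all $(z',\gamma')\in\widetilde{\mathfrak{Z}}_n$, $n\ge0$; (ii) $\tilde\nu(z,\gamma)=\gamma^\beta\tilde\nu(z,1)$ for all $(z,\gamma)\in\widetilde{\mathfrak{Z}}$; (iii) $\tilde\nu(1,1)=1$. *)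

theory Defs
  imports
    "HOL-Analysis.Infinite_Sum"
    "HOL-Algebra.Generated_Groups"
    "Jordan_Normal_Form.Schur_Decomposition"
begin

section \<open>Unital C*-algebras and W*-subalgebras\<close>

class cstar_algebra = real_normed_algebra_1 + banach +
  fixes scaleC :: "complex \<Rightarrow> 'a \<Rightarrow> 'a" (infixr \<open>*\<^sub>C\<close> 75)
    and star :: "'a \<Rightarrow> 'a"
  assumes scaleC_of_real: "of_real r *\<^sub>C x = r *\<^sub>R x"
    and scaleC_add_left: "(c + c') *\<^sub>C x = c *\<^sub>C x + c' *\<^sub>C x"
    and scaleC_add_right: "c *\<^sub>C (x + y) = c *\<^sub>C x + c *\<^sub>C y"
    and scaleC_scaleC: "c *\<^sub>C (c' *\<^sub>C x) = (c * c') *\<^sub>C x"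
    and scaleC_mult_left: "(c *\<^sub>C x) * y = c *\<^sub>C (x * y)"
    and scaleC_mult_right: "x * (c *\<^sub>C y) = c *\<^sub>C (x * y)"
    and norm_scaleC: "norm (c *\<^sub>C x) = cmod c * norm x"
    and star_add: "star (x + y) = star x + star y"
    and star_scaleC: "star (c *\<^sub>C x) = cnj c *\<^sub>C star x"
    and star_mult: "star (x * y) = star y * star x"
    and star_star: "star (star x) = x"
    and cstar_identity: "norm (star x * x) = (norm x)\<^sup>2"

definition cstar_subalgebra :: "'a::cstar_algebra set \<Rightarrow> bool" where
  "cstar_subalgebra M \<longleftrightarrow> 1 \<in> M \<and> closed M \<and>
     (\<forall>x\<in>M. \<forall>y\<in>M. x + y \<in> M \<and> x * y \<in> M) \<and>
     (\<forall>x\<in>M. star x \<in> M \<and> (\<forall>c. c *\<^sub>C x \<in> M))"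

definition star_automorphism :: "('a::cstar_algebra \<Rightarrow> 'a) \<Rightarrow> bool" where
  "star_automorphism f \<longleftrightarrow> bij f \<and>
     (\<forall>x y. f (x + y) = f x + f y \<and> f (x * y) = f x * f y) \<and>
     (\<forall>x. f (star x) = star (f x) \<and> (\<forall>c. f (c *\<^sub>C x) = c *\<^sub>C f x))"

definition projections :: "'a::cstar_algebra set \<Rightarrow> 'a set" where
  "projections M = {p \<in> M. star p = p \<and> p * p = p}"

text \<open>For projections, \<open>q \<le> p\<close> is \<open>p * q = q\<close>.\<close>

definition minimal_projections :: "'a::cstar_algebra set \<Rightarrow> 'a set" where
  "minimal_projections M =
     {p \<in> projections M. p \<noteq> 0 \<and> (\<forall>q\<in>projections M. p * q = q \<longrightarrow> q = 0 \<or> q = p)}"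

definition alg_center :: "'a::cstar_algebra set \<Rightarrow> 'a set" where
  "alg_center M = {z \<in> M. \<forall>x\<in>M. z * x = x * z}"

text \<open>The dual of a subalgebra \<open>M\<close>: functionals are represented by functions that are
  \<open>undefined\<close> outside \<open>M\<close>.\<close>

definition dual_space :: "'a::cstar_algebra set \<Rightarrow> ('a \<Rightarrow> complex) set" where
  "dual_space M = {\<phi> \<in> extensional M.
     (\<forall>x\<in>M. \<forall>y\<in>M. \<phi> (x + y) = \<phi> x + \<phi> y) \<and>
     (\<forall>x\<in>M. \<forall>c. \<phi> (c *\<^sub>C x) = c * \<phi> x) \<and>
     (\<exists>B. \<forall>x\<in>M. cmod (\<phi> x) \<le> B * norm x)}"

definition dual_norm :: "'a::cstar_algebra set \<Rightarrow> ('a \<Rightarrow> complex) \<Rightarrow> real" where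
  "dual_norm M \<phi> = (SUP x\<in>{x \<in> M. norm x \<le> 1}. cmod (\<phi> x))"

text \<open>\<open>P\<close> is the predual of the W*-algebra \<open>M\<close>, realised inside the dual of \<open>M\<close>:
  a closed subspace such that evaluation is an isometric isomorphism of \<open>M\<close> onto the
  dual of \<open>P\<close>.\<close>

definition is_predual :: "'a::cstar_algebra set \<Rightarrow> ('a \<Rightarrow> complex) set \<Rightarrow> bool" where
  "is_predual M P \<longleftrightarrow>
     P \<subseteq> dual_space M \<and>
     (\<lambda>x\<in>M. 0) \<in> P \<and>
     (\<forall>\<phi>\<in>P. \<forall>\<psi>\<in>P. (\<lambda>x\<in>M. \<phi> x + \<psi> x) \<in> P) \<and>
     (\<forall>\<phi>\<in>P. \<forall>c. (\<lambda>x\<in>M. c * \<phi> x) \<in> P) \<and>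
     (\<forall>\<phi>\<in>dual_space M. (\<forall>e>0. \<exists>\<psi>\<in>P. dual_norm M (\<lambda>x. \<phi> x - \<psi> x) < e) \<longrightarrow> \<phi> \<in> P) \<and>
     (\<forall>x\<in>M. norm x = (SUP \<phi>\<in>{\<phi> \<in> P. dual_norm M \<phi> \<le> 1}. cmod (\<phi> x))) \<and>
     (\<forall>F. (\<forall>\<phi>\<in>P. \<forall>\<psi>\<in>P. F (\<lambda>x\<in>M. \<phi> x + \<psi> x) = F \<phi> + F \<psi>) \<and>
          (\<forall>\<phi>\<in>P. \<forall>c. F (\<lambda>x\<in>M. c * \<phi> x) = c * F \<phi>) \<and>
          (\<exists>B. \<forall>\<phi>\<in>P. cmod (F \<phi>) \<le> B * dual_norm M \<phi>)
        \<longrightarrow> (\<exists>x\<in>M. \<forall>\<phi>\<in>P. F \<phi> = \<phi> x))"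

definition separable_predual :: "'a::cstar_algebra set \<Rightarrow> ('a \<Rightarrow> complex) set \<Rightarrow> bool" where
  "separable_predual M P \<longleftrightarrow>
     (\<exists>D\<subseteq>P. countable D \<and> (\<forall>\<phi>\<in>P. \<forall>e>0. \<exists>\<psi>\<in>D. dual_norm M (\<lambda>x. \<phi> x - \<psi> x) < e))"

definition atomic :: "'a::cstar_algebra set \<Rightarrow> bool" where
  "atomic M \<longleftrightarrow> (\<forall>p\<in>projections M. p \<noteq> 0 \<longrightarrow> (\<exists>e\<in>minimal_projections M. p * e = e))"


section \<open>Complex matrices\<close>

definition mat_trace :: "complex mat \<Rightarrow> complex" where
  "mat_trace R = (\<Sum>i<dim_row R. R $$ (i, i))"

text \<open>The orthogonal projection onto the eigenspace of \<open>R\<close> for \<open>\<gamma>\<close>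
  (zero if \<open>\<gamma>\<close> is not an eigenvalue).\<close>

definition eigenspace_projection :: "complex mat \<Rightarrow> real \<Rightarrow> complex mat" where
  "eigenspace_projection R \<gamma> =
     (THE Q. Q \<in> carrier_mat (dim_row R) (dim_row R) \<and> mat_adjoint Q = Q \<and> Q * Q = Q \<and>
        (\<forall>v\<in>carrier_vec (dim_row R).
           Q *\<^sub>v v = v \<longleftrightarrow> R *\<^sub>v v = complex_of_real \<gamma> \<cdot>\<^sub>v v))"

definition pos_reals :: "real monoid" where
  "pos_reals = \<lparr>carrier = {0<..}, mult = (*), one = 1\<rparr>"


section \<open>Links and harmonic functions\<close>

text \<open>\<open>A n\<close> is the \<open>n\<close>-th algebra; \<open>\<pi> n z\<close> is the identification of \<open>zA\<^sub>n\<close>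
  with \<open>B(H\<^sub>z)\<close>, where \<open>H\<^sub>z\<close> is the Hilbert space of column vectors of dimension
  \<open>d n z\<close>; \<open>\<rho> n z\<close> is the weight operator. Since the sets of minimal central projections
  of different levels may overlap inside the ambient algebra, the index \<open>n\<close> is carried along
  everywhere, and the disjoint union of the levels consists of pairs \<open>(n, z)\<close>.\<close>

locale weighted_tower =
  fixes A :: "nat \<Rightarrow> 'a::cstar_algebra set"
    and d :: "nat \<Rightarrow> 'a \<Rightarrow> nat"
    and \<pi> :: "nat \<Rightarrow> 'a \<Rightarrow> 'a \<Rightarrow> complex mat"
    and \<rho> :: "nat \<Rightarrow> 'a \<Rightarrow> 'a"
begin

definition Z :: "nat \<Rightarrow> 'a set" where
  "Z n = minimal_projections (alg_center (A n))"

definition ZZ :: "(nat \<times> 'a) set" where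
  "ZZ = (SIGMA n:UNIV. Z n)"

definition corner :: "nat \<Rightarrow> 'a \<Rightarrow> 'a set" where
  "corner n z = (\<lambda>x. z * x) ` A n"

definition Tr :: "nat \<Rightarrow> 'a \<Rightarrow> 'a \<Rightarrow> complex" where
  "Tr n z x = mat_trace (\<pi> n z x)"

definition eigvals :: "nat \<Rightarrow> 'a \<Rightarrow> real set" where
  "eigvals n z = {\<gamma>. eigenvalue (\<pi> n z (\<rho> n z)) (complex_of_real \<gamma>)}"

definition p :: "nat \<Rightarrow> 'a \<Rightarrow> real \<Rightarrow> 'a" where
  "p n z \<gamma> = inv_into (corner n z) (\<pi> n z) (eigenspace_projection (\<pi> n z (\<rho> n z)) \<gamma>)"

text \<open>All eigenvalues of \<open>\<rho> n z\<close> are positive in the setting below, so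
  \<open>exp (s * ln \<gamma>)\<close> is the power \<open>\<gamma>\<^sup>s\<close>.\<close>

definition rho_power :: "nat \<Rightarrow> 'a \<Rightarrow> complex \<Rightarrow> 'a" where
  "rho_power n z s = (\<Sum>\<gamma>\<in>eigvals n z. exp (s * complex_of_real (ln \<gamma>)) *\<^sub>C p n z \<gamma>)"

text \<open>The traces below are real numbers; \<open>Re\<close> only changes the type.\<close>

definition dim_beta :: "real \<Rightarrow> nat \<Rightarrow> 'a \<Rightarrow> real" where
  "dim_beta \<beta> n z = Re (Tr n z (rho_power n z (complex_of_real (- \<beta>))))"

text \<open>In \<open>kappa\<close>, \<open>multiplicity\<close>, \<open>q\<close> and \<open>mu\<close> the index \<open>n\<close> is the level of the
  lower vertex \<open>z'\<close>; the upper vertex \<open>z\<close> has level \<open>n + 1\<close>.\<close>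

definition kappa :: "real \<Rightarrow> nat \<Rightarrow> 'a \<Rightarrow> 'a \<Rightarrow> real" where
  "kappa \<beta> n z z' =
     Re (Tr (Suc n) z (rho_power (Suc n) z (complex_of_real (- \<beta>)) * z')) / dim_beta \<beta> (Suc n) z"

text \<open>The multiplicity of \<open>B(H\<^sub>z\<^sub>')\<close> in \<open>B(H\<^sub>z)\<close>: the largest number of mutually orthogonal
  copies of the irreducible representation \<open>H\<^sub>z\<^sub>'\<close> of \<open>z'A\<^sub>n\<close> in its representation
  \<open>x \<mapsto> zx\<close> on \<open>H\<^sub>z\<close>, each copy given by an isometric intertwiner \<open>V i\<close>.\<close>

definition multiplicity :: "nat \<Rightarrow> 'a \<Rightarrow> 'a \<Rightarrow> nat" where
  "multiplicity n z z' = Max {k. \<exists>V :: nat \<Rightarrow> complex mat.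
     (\<forall>i<k. V i \<in> carrier_mat (d (Suc n) z) (d n z') \<and>
        (\<forall>x\<in>corner n z'. \<pi> (Suc n) z (z * x) * V i = V i * \<pi> n z' x)) \<and>
     (\<forall>i<k. \<forall>j<k. mat_adjoint (V i) * V j =
        (if i = j then 1\<^sub>m (d n z') else 0\<^sub>m (d n z') (d n z')))}"

definition \<Gamma> :: "real set" where
  "\<Gamma> = generate pos_reals (\<Union>(n, z)\<in>ZZ. eigvals n z)"

text \<open>Only finitely many terms of the following sum are nonzero.\<close>

definition q :: "nat \<Rightarrow> 'a \<Rightarrow> 'a \<Rightarrow> real \<Rightarrow> 'a" where
  "q n z z' \<gamma> = (\<Sum>\<^sub>\<infinity>\<gamma>'\<in>\<Gamma>. p (Suc n) z (\<gamma> * \<gamma>') * p n z' \<gamma>')"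

definition mu :: "nat \<Rightarrow> 'a \<times> real \<Rightarrow> 'a \<times> real \<Rightarrow> real" where
  "mu n = (\<lambda>(z, \<gamma>) (z', \<gamma>').
     if multiplicity n z z' > 0
     then Re (Tr (Suc n) z (q n z z' (inverse \<gamma> * \<gamma>'))) / real (d (Suc n) z)
     else 0)"

text \<open>In the next two definitions \<open>has_sum\<close> includes the convergence of the series.\<close>

definition harmonic_kappa :: "real \<Rightarrow> (nat \<times> 'a \<Rightarrow> real) set" where
  "harmonic_kappa \<beta> = {\<nu> \<in> ZZ \<rightarrow>\<^sub>E {0..}.
     (\<forall>n. \<forall>z'\<in>Z n. ((\<lambda>z. \<nu> (Suc n, z) * kappa \<beta> n z z') has_sum \<nu> (n, z')) (Z (Suc n))) \<and>
     \<nu> (0, 1) = 1}"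

definition harmonic_mu :: "real \<Rightarrow> ((nat \<times> 'a) \<times> real \<Rightarrow> real) set" where
  "harmonic_mu \<beta> = {\<nu> \<in> ZZ \<times> \<Gamma> \<rightarrow>\<^sub>E {0..}.
     (\<forall>n. \<forall>z'\<in>Z n. \<forall>\<gamma>'\<in>\<Gamma>.
        ((\<lambda>(z, \<gamma>). \<nu> ((Suc n, z), \<gamma>) * mu n (z, \<gamma>) (z', \<gamma>'))
           has_sum \<nu> ((n, z'), \<gamma>')) (Z (Suc n) \<times> \<Gamma>)) \<and>
     (\<forall>n. \<forall>z\<in>Z n. \<forall>\<gamma>\<in>\<Gamma>. \<nu> ((n, z), \<gamma>) = \<gamma> powr \<beta> * \<nu> ((n, z), 1)) \<and>
     \<nu> ((0, 1), 1) = 1}"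

end


section \<open>The setting\<close>

text \<open>The ambient C*-algebra is the type \<open>'a\<close>. It is the inductive limit of the \<open>A n\<close>, the
  connecting maps being the inclusions. \<open>P n\<close> is the predual of \<open>A n\<close>.

  The flow is equal to \<open>Ad \<rho>\<^sub>z\<^sup>i\<^sup>t\<close> on \<open>zA\<^sub>n\<close> for exactly one positive invertible
  \<open>\<rho>\<^sub>z\<close> with the given trace normalisation, so that assuming this property of \<open>\<rho>\<close> imposes no
  condition on the flow.\<close>

locale flow_on_tower = weighted_tower A d \<pi> \<rho>
  for A :: "nat \<Rightarrow> 'a::cstar_algebra set"
    and d :: "nat \<Rightarrow> 'a \<Rightarrow> nat"
    and \<pi> :: "nat \<Rightarrow> 'a \<Rightarrow> 'a \<Rightarrow> complex mat"
    and \<rho> :: "nat \<Rightarrow> 'a \<Rightarrow> 'a" +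
  fixes P :: "nat \<Rightarrow> ('a \<Rightarrow> complex) set"
    and \<alpha> :: "real \<Rightarrow> 'a \<Rightarrow> 'a"
  assumes A_0: "A 0 = range (\<lambda>c. c *\<^sub>C 1)"
    and A_subalgebra: "\<And>n. cstar_subalgebra (A n)"
    and A_predual: "\<And>n. is_predual (A n) (P n)"
    and A_separable: "\<And>n. separable_predual (A n) (P n)"
    and A_atomic: "\<And>n. atomic (A n)"
    and A_inclusion: "\<And>n. A n \<subseteq> A (Suc n)"
    and A_inclusion_normal: "\<And>n \<phi>. \<phi> \<in> P (Suc n) \<Longrightarrow> restrict \<phi> (A n) \<in> P n"
    and A_limit: "closure (\<Union>n. A n) = UNIV"
    and \<pi>_bij: "\<And>n z. z \<in> Z n \<Longrightarrow>
          bij_betw (\<pi> n z) (corner n z) (carrier_mat (d n z) (d n z))"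
    and \<pi>_add: "\<And>n z x y. \<lbrakk>z \<in> Z n; x \<in> corner n z; y \<in> corner n z\<rbrakk> \<Longrightarrow>
          \<pi> n z (x + y) = \<pi> n z x + \<pi> n z y"
    and \<pi>_mult: "\<And>n z x y. \<lbrakk>z \<in> Z n; x \<in> corner n z; y \<in> corner n z\<rbrakk> \<Longrightarrow>
          \<pi> n z (x * y) = \<pi> n z x * \<pi> n z y"
    and \<pi>_scaleC: "\<And>n z x c. \<lbrakk>z \<in> Z n; x \<in> corner n z\<rbrakk> \<Longrightarrow>
          \<pi> n z (c *\<^sub>C x) = c \<cdot>\<^sub>m \<pi> n z x"
    and \<pi>_star: "\<And>n z x. \<lbrakk>z \<in> Z n; x \<in> corner n z\<rbrakk> \<Longrightarrow>
          \<pi> n z (star x) = mat_adjoint (\<pi> n z x)"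
    and \<alpha>_automorphism: "\<And>t. star_automorphism (\<alpha> t)"
    and \<alpha>_0: "\<alpha> 0 = id"
    and \<alpha>_add: "\<And>s t. \<alpha> (s + t) = \<alpha> s \<circ> \<alpha> t"
    and \<alpha>_A: "\<And>n t. \<alpha> t ` A n = A n"
    and \<alpha>_u_continuous: "\<And>n \<phi> s. \<phi> \<in> P n \<Longrightarrow>
          ((\<lambda>t. dual_norm (A n) (\<lambda>x. \<phi> (\<alpha> t x) - \<phi> (\<alpha> s x))) \<longlongrightarrow> 0) (at s)"
    and \<rho>_positive: "\<And>n z. z \<in> Z n \<Longrightarrow> \<exists>y\<in>corner n z. \<rho> n z = star y * y"
    and \<rho>_invertible_normalized: "\<And>n z. z \<in> Z n \<Longrightarrow>
          \<exists>\<sigma>\<in>corner n z. \<rho> n z * \<sigma> = z \<and> \<sigma> * \<rho> n z = z \<and> Tr n z (\<rho> n z) = Tr n z \<sigma>"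
    and \<rho>_implements: "\<And>n z t x. \<lbrakk>z \<in> Z n; x \<in> corner n z\<rbrakk> \<Longrightarrow>
          \<alpha> t x = rho_power n z (\<i> * complex_of_real t) * x *
                  star (rho_power n z (\<i> * complex_of_real t))"


section \<open>Affine isomorphisms\<close>

text \<open>Convex combinations are pointwise; they preserve the value \<open>undefined\<close> of extensional
  functions outside their domain.\<close>

definition convex_comb :: "real \<Rightarrow> ('b \<Rightarrow> real) \<Rightarrow> ('b \<Rightarrow> real) \<Rightarrow> 'b \<Rightarrow> real" where
  "convex_comb t f g = (\<lambda>x. t * f x + (1 - t) * g x)"

definition convex_funs :: "('b \<Rightarrow> real) set \<Rightarrow> bool" where
  "convex_funs X \<longleftrightarrow> (\<forall>f\<in>X. \<forall>g\<in>X. \<forall>t\<in>{0..1}. convex_comb t f g \<in> X)"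

definition affine_isomorphism ::
    "('b \<Rightarrow> real) set \<Rightarrow> ('c \<Rightarrow> real) set \<Rightarrow> (('b \<Rightarrow> real) \<Rightarrow> ('c \<Rightarrow> real)) \<Rightarrow> bool" where
  "affine_isomorphism X Y F \<longleftrightarrow> convex_funs X \<and> convex_funs Y \<and> bij_betw F X Y \<and>
     (\<forall>f\<in>X. \<forall>g\<in>X. \<forall>t\<in>{0..1}. F (convex_comb t f g) = convex_comb t (F f) (F g))"

end

theory Submission
  imports Defs
begin

text \<open>Substituting \<open>\<nu>~(z, \<gamma>) = dim z / dim\<^sub>\<beta> z \<sqdot> \<nu> z \<sqdot> \<gamma>\<^sup>\<beta>\<close> into the harmonicity equation of the
  extended graph and summing over \<open>\<gamma>\<close> first leaves
  \<open>Tr (\<rho>\<^sub>z\<^sup>-\<^sup>\<beta> \<rho>\<^sub>z\<^sub>'\<^sup>\<beta>)\<close>. Since \<open>\<rho>\<^sub>z\<^sup>i\<^sup>t\<close> and \<open>\<rho>\<^sub>z\<^sub>'\<^sup>i\<^sup>t\<close> implement the same flow on the lower algebra,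
  \<open>W = \<rho>\<^sub>z\<^sup>-\<^sup>\<beta> \<rho>\<^sub>z\<^sub>'\<^sup>\<beta>\<close> commutes with \<open>z'A\<^sub>n\<close>, so \<open>x \<mapsto> Tr (W x)\<close> is a multiple of the
  trace of \<open>B(H\<^sub>z\<^sub>')\<close>. Comparing its values at the unit and at \<open>\<rho>\<^sub>z\<^sub>'\<^sup>-\<^sup>\<beta>\<close> gives
  \<open>Tr W \<sqdot> dim\<^sub>\<beta> z' = dim z' \<sqdot> Tr (\<rho>\<^sub>z\<^sup>-\<^sup>\<beta> z')\<close>, which turns the equation into \<open>\<kappa>\<close>-harmonicity.\<close>

text \<open>The obstacle is that the flow relates only imaginary powers of the two weights, while
  \<open>W\<close> is built from real powers. Instead of continuing analytically, an element of the
  lower corner is cut into blocks between joint eigenprojections of the two commuting weights. Seen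
  from below and from above, the flow multiplies such a block by a character of \<open>t\<close>; on
  a nonzero block the two characters agree, hence so do the two quotients of eigenvalues and all
  their real powers. Summing over \<gamma> first works because \<Gamma> is a group: for a fixed
  lower eigenvalue \<delta>, the involution \<epsilon> -> \<gamma>'\<delta>/\<epsilon> of \<Gamma>
  turns the sum into one over the finitely many upper eigenvalues. The sum over z may be infinite;
  there nonnegativity permits passing between the double and the iterated sum. Two side conditions
  remain. The case split in \<open>mu\<close> is harmless, because the multiplicity is positive when
  z z' is nonzero and all traces vanish otherwise. At the root the trace normalisation forces the
  weight to be 1, so both normalisations are the same condition.\<close>

lemma scaleC_1 [simp]: "1 *\<^sub>C x = (x :: 'a::cstar_algebra)"
  using scaleC_of_real[of 1 x] by simp

lemma scaleC_0 [simp]: "0 *\<^sub>C x = (0 :: 'a::cstar_algebra)"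
  using scaleC_of_real[of 0 x] by simp

lemma scaleC_minus_1: "(- 1) *\<^sub>C x = - (x :: 'a::cstar_algebra)"
  using scaleC_of_real[of "-1" x] by simp

lemma scaleC_zero [simp]: "c *\<^sub>C 0 = (0 :: 'a::cstar_algebra)"
  using scaleC_add_right[of c 0 "0::'a"] by simp

lemma scaleC_minus_left: "(- c) *\<^sub>C x = - (c *\<^sub>C (x :: 'a::cstar_algebra))"
  using scaleC_scaleC[of "-1" c x] by (simp add: scaleC_minus_1)

lemma scaleC_diff_left: "(b - c) *\<^sub>C x = b *\<^sub>C x - c *\<^sub>C (x :: 'a::cstar_algebra)"
  using scaleC_add_left[of b "-c" x] by (simp add: scaleC_minus_left)

lemma scaleC_sum_right: "c *\<^sub>C (\<Sum>i\<in>I. f i) = (\<Sum>i\<in>I. c *\<^sub>C (f i :: 'a::cstar_algebra))"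
  by (induction I rule: infinite_finite_induct) (simp_all add: scaleC_add_right)

lemma scaleC_minus_right: "c *\<^sub>C (- x) = - (c *\<^sub>C (x :: 'a::cstar_algebra))"
  using scaleC_add_right[of c x "-x"] by (simp add: eq_neg_iff_add_eq_0 add.commute)

lemma scaleC_diff_right: "c *\<^sub>C (x - y) = c *\<^sub>C x - c *\<^sub>C (y :: 'a::cstar_algebra)"
  using scaleC_add_right[of c x "-y"] by (simp add: scaleC_minus_right)

lemma scaleC_eq_0_iff [simp]: "c *\<^sub>C x = 0 \<longleftrightarrow> c = 0 \<or> x = (0 :: 'a::cstar_algebra)"
proof
  assume "c *\<^sub>C x = 0"
  then show "c = 0 \<or> x = 0"
    using norm_scaleC[of c x] by simp
qed auto

lemma scaleC_right_cancel:
  assumes "b *\<^sub>C x = c *\<^sub>C (x :: 'a::cstar_algebra)" "b \<noteq> c"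
  shows "x = 0"
  using assms scaleC_diff_left[of b c x] by simp

lemma star_zero [simp]: "star 0 = (0 :: 'a::cstar_algebra)"
  using star_add[of 0 "0::'a"] by simp

lemma star_minus: "star (- x) = - star (x :: 'a::cstar_algebra)"
  using star_add[of x "-x"] by (simp add: eq_neg_iff_add_eq_0 add.commute)

lemma star_diff: "star (x - y) = star x - star (y :: 'a::cstar_algebra)"
  using star_add[of x "-y"] by (simp add: star_minus)

lemma star_sum: "star (\<Sum>i\<in>I. f i) = (\<Sum>i\<in>I. star (f i :: 'a::cstar_algebra))"
  by (induction I rule: infinite_finite_induct) (simp_all add: star_add)

lemma star_one [simp]: "star 1 = (1 :: 'a::cstar_algebra)"
  by (metis mult_1 mult.right_neutral star_mult star_star)

lemma star_mult_self_eq_0: "star x * x = 0 \<Longrightarrow> x = (0 :: 'a::cstar_algebra)"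
  using cstar_identity[of x] by simp

section \<open>Adjoints, traces and orthogonal projections of complex matrices\<close>

lemma index_mat_adjoint [simp]:
  assumes "i < dim_col A" "j < dim_row A"
  shows "mat_adjoint A $$ (i, j) = conjugate (A $$ (j, i))"
  using assms unfolding mat_adjoint_def by (simp add: mat_of_rows_index)

lemma dim_mat_adjoint [simp]:
  "dim_row (mat_adjoint A) = dim_col A" "dim_col (mat_adjoint A) = dim_row A"
  unfolding mat_adjoint_def by simp_all

lemma mat_adjoint_carrier [simp]: "A \<in> carrier_mat m n \<Longrightarrow> mat_adjoint A \<in> carrier_mat n m"
  unfolding carrier_mat_def by simp

lemma mat_adjoint_mult:
  fixes A B :: "complex mat"
  assumes "A \<in> carrier_mat l m" "B \<in> carrier_mat m n"
  shows "mat_adjoint (A * B) = mat_adjoint B * mat_adjoint A"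
proof (rule eq_matI)
  fix i j assume "i < dim_row (mat_adjoint B * mat_adjoint A)" "j < dim_col (mat_adjoint B * mat_adjoint A)"
  with assms have "i < n" "j < l" by auto
  then show "mat_adjoint (A * B) $$ (i, j) = (mat_adjoint B * mat_adjoint A) $$ (i, j)"
    using assms by (simp add: scalar_prod_def mult.commute)
qed (use assms in auto)

lemma mat_trace_mult_comm:
  assumes "A \<in> carrier_mat m n" "B \<in> carrier_mat n m"
  shows "mat_trace (A * B) = mat_trace (B * A)"
  using assms sum.swap[of "\<lambda>i j. A $$ (i, j) * B $$ (j, i)" "{..<n}" "{..<m}"]
  by (auto simp: mat_trace_def scalar_prod_def mult.commute lessThan_atLeast0)

lemma mat_trace_add:
  assumes "A \<in> carrier_mat n n" "B \<in> carrier_mat n n"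
  shows "mat_trace (A + B) = mat_trace A + mat_trace B"
  using assms by (auto simp: mat_trace_def sum.distrib)

lemma mat_trace_smult: "A \<in> carrier_mat n n \<Longrightarrow> mat_trace (c \<cdot>\<^sub>m A) = c * mat_trace A"
  by (auto simp: mat_trace_def sum_distrib_left)

lemma mat_trace_adjoint_mult:
  assumes "A \<in> carrier_mat m n"
  shows "mat_trace (mat_adjoint A * A) = of_real (\<Sum>i<n. \<Sum>j<m. (cmod (A $$ (j, i)))\<^sup>2)"
  using assms
  by (auto simp: mat_trace_def scalar_prod_def lessThan_atLeast0 complex_norm_square mult.commute
      intro!: sum.cong simp del: of_real_power)

text \<open>With \<open>s = r - c\<close> this excludes Jordan blocks. Algebra elements take the
  place of vectors and \<open>star w * w\<close> that of the squared length, so the C*-identity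
  concludes.\<close>

lemma selfadjoint_kernel_square:
  fixes s w :: "'a::cstar_algebra"
  assumes "star s = s" "s * (s * w) = 0"
  shows "s * w = 0"
proof -
  have "star (s * w) * (s * w) = star w * (s * (s * w))"
    using assms(1) by (simp add: star_mult mult.assoc)
  then show ?thesis using assms(2) star_mult_self_eq_0 by simp
qed

lemma selfadjoint_eigenvalue_real:
  fixes r w :: "'a::cstar_algebra"
  assumes "star r = r" "r * w = c *\<^sub>C w" "w \<noteq> 0"
  shows "cnj c = c"
proof (rule ccontr)
  assume "cnj c \<noteq> c"
  have "star w * (r * w) = c *\<^sub>C (star w * w)"
    using assms(2) by (simp add: scaleC_mult_right)
  moreover from arg_cong[OF this, of star] have "star w * (r * w) = cnj c *\<^sub>C (star w * w)"
    using assms(1) by (simp add: star_mult star_star star_scaleC mult.assoc)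
  ultimately have "star w * w = 0"
    using scaleC_right_cancel \<open>cnj c \<noteq> c\<close> by metis
  then show False using assms(3) star_mult_self_eq_0 by blast
qed

lemma smult_unit_mult_vec:
  assumes "v \<in> carrier_vec n"
  shows "(c \<cdot>\<^sub>m 1\<^sub>m n) *\<^sub>v v = c \<cdot>\<^sub>v (v :: complex vec)"
proof (rule eq_vecI)
  fix i assume "i < dim_vec (c \<cdot>\<^sub>v v)"
  then have i: "i < n" using assms by simp
  then have "((c \<cdot>\<^sub>m 1\<^sub>m n) *\<^sub>v v) $ i = (\<Sum>j = 0..<n. c * (if j = i then 1 else 0) * v $ j)"
    using assms by (simp add: scalar_prod_def)
  also have "\<dots> = (\<Sum>j = 0..<n. if j = i then c * v $ i else 0)"
    by (rule sum.cong) auto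
  finally show "((c \<cdot>\<^sub>m 1\<^sub>m n) *\<^sub>v v) $ i = (c \<cdot>\<^sub>v v) $ i"
    using assms i by simp
qed (use assms in auto)

text \<open>This makes the definite description in \<open>eigenspace_projection\<close> well
  defined. Each column of a projection is fixed by it, hence by the other one, so each projection
  absorbs the other from the left; taking the adjoint of one of these equations identifies the
  two.\<close>

lemma orthogonal_projection_unique:
  fixes Q Q' :: "complex mat"
  assumes Q: "Q \<in> carrier_mat n n" "mat_adjoint Q = Q" "Q * Q = Q"
    and Q': "Q' \<in> carrier_mat n n" "mat_adjoint Q' = Q'" "Q' * Q' = Q'"
    and range: "\<And>v. v \<in> carrier_vec n \<Longrightarrow> Q *\<^sub>v v = v \<longleftrightarrow> Q' *\<^sub>v v = v"
  shows "Q = Q'"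
proof -
  have absorb: "M * N = N"
    if M: "M \<in> carrier_mat n n" and N: "N \<in> carrier_mat n n" "N * N = N"
      and MN: "\<And>v. v \<in> carrier_vec n \<Longrightarrow> N *\<^sub>v v = v \<Longrightarrow> M *\<^sub>v v = v" for M N :: "complex mat"
  proof (rule mat_col_eqI)
    fix j assume "j < dim_col N"
    then have j: "j < n" using N by simp
    have "N *\<^sub>v col N j = col N j" using N j col_mult2[of N n n N n j] by simp
    moreover have "col N j \<in> carrier_vec n" using N by (metis carrier_matD(1) col_dim)
    ultimately have "M *\<^sub>v col N j = col N j" using MN by blast
    then show "col (M * N) j = col N j" using M N j col_mult2[of M n n N n j] by simp
  qed (use M N in auto)
  have "Q * Q' = Q'" "Q' * Q = Q"
    using absorb Q Q' range by blast+
  then show ?thesis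
    using mat_adjoint_mult[OF Q(1) Q'(1)] Q(2) Q'(2) by simp
qed

section \<open>Matrix corners of a C*-algebra\<close>

text \<open>An abstract \<open>zA\<^sub>n\<close> with its identification with a full matrix
  algebra. The unit \<open>e\<close> is in general not the unit of the ambient algebra. That \<phi>
  maps \<open>e\<close> to the identity matrix follows from surjectivity, and \<open>d > 0\<close>
  from \<open>e\<close> being nonzero.\<close>

locale matrix_corner =
  fixes C :: "'a::cstar_algebra set" and e :: 'a and \<phi> :: "'a \<Rightarrow> complex mat" and d :: nat
  assumes add_closed: "\<lbrakk>x \<in> C; y \<in> C\<rbrakk> \<Longrightarrow> x + y \<in> C"
    and mult_closed: "\<lbrakk>x \<in> C; y \<in> C\<rbrakk> \<Longrightarrow> x * y \<in> C"
    and star_closed: "x \<in> C \<Longrightarrow> star x \<in> C"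
    and scaleC_closed: "x \<in> C \<Longrightarrow> c *\<^sub>C x \<in> C"
    and unit_closed: "e \<in> C"
    and unit_left: "x \<in> C \<Longrightarrow> e * x = x"
    and unit_right: "x \<in> C \<Longrightarrow> x * e = x"
    and unit_nonzero: "e \<noteq> 0"
    and \<phi>_bij: "bij_betw \<phi> C (carrier_mat d d)"
    and \<phi>_add: "\<lbrakk>x \<in> C; y \<in> C\<rbrakk> \<Longrightarrow> \<phi> (x + y) = \<phi> x + \<phi> y"
    and \<phi>_mult: "\<lbrakk>x \<in> C; y \<in> C\<rbrakk> \<Longrightarrow> \<phi> (x * y) = \<phi> x * \<phi> y"
    and \<phi>_scaleC: "x \<in> C \<Longrightarrow> \<phi> (c *\<^sub>C x) = c \<cdot>\<^sub>m \<phi> x"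
    and \<phi>_star: "x \<in> C \<Longrightarrow> \<phi> (star x) = mat_adjoint (\<phi> x)"
begin

lemma \<phi>_carrier: "x \<in> C \<Longrightarrow> \<phi> x \<in> carrier_mat d d"
  using \<phi>_bij by (auto simp: bij_betw_def)

lemma \<phi>_dim [simp]: "x \<in> C \<Longrightarrow> dim_row (\<phi> x) = d" "x \<in> C \<Longrightarrow> dim_col (\<phi> x) = d"
  using \<phi>_carrier by auto

lemma \<phi>_inj: "\<lbrakk>\<phi> x = \<phi> y; x \<in> C; y \<in> C\<rbrakk> \<Longrightarrow> x = y"
  using \<phi>_bij by (auto simp: bij_betw_def inj_on_def)

lemma \<phi>_surj:
  assumes "M \<in> carrier_mat d d"
  obtains x where "x \<in> C" "\<phi> x = M"
  using assms \<phi>_bij by (metis bij_betw_imp_surj_on imageE)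

lemma inv_\<phi>_closed: "M \<in> carrier_mat d d \<Longrightarrow> inv_into C \<phi> M \<in> C"
  using \<phi>_bij by (metis bij_betw_def inv_into_into)

lemma \<phi>_inv_\<phi>: "M \<in> carrier_mat d d \<Longrightarrow> \<phi> (inv_into C \<phi> M) = M"
  using bij_betw_inv_into_right[OF \<phi>_bij] .

lemma zero_closed: "0 \<in> C"
  using scaleC_closed[OF unit_closed, of 0] by simp

lemma diff_closed: "\<lbrakk>x \<in> C; y \<in> C\<rbrakk> \<Longrightarrow> x - y \<in> C"
  using add_closed[OF _ scaleC_closed[of y "-1"], of x] by (simp add: scaleC_minus_1)

lemma sum_closed: "(\<And>i. i \<in> I \<Longrightarrow> f i \<in> C) \<Longrightarrow> sum f I \<in> C"
  by (induction I rule: infinite_finite_induct) (auto simp: zero_closed add_closed)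

lemmas closed = add_closed mult_closed star_closed scaleC_closed unit_closed zero_closed
  diff_closed sum_closed

lemma star_unit: "star e = e"
  by (metis star_mult star_star unit_left star_closed unit_closed)

lemma \<phi>_zero: "\<phi> 0 = 0\<^sub>m d d"
proof -
  have "\<phi> 0 = 0 \<cdot>\<^sub>m \<phi> e" using \<phi>_scaleC[OF unit_closed, of 0] by simp
  then show ?thesis using \<phi>_carrier[OF unit_closed] by auto
qed

lemma \<phi>_unit: "\<phi> e = 1\<^sub>m d"
proof -
  obtain x where x: "x \<in> C" "\<phi> x = 1\<^sub>m d" by (rule \<phi>_surj[of "1\<^sub>m d"]) auto
  have "\<phi> x = \<phi> e * \<phi> x" using x unit_left \<phi>_mult[OF unit_closed x(1)] by simp
  then show ?thesis using x \<phi>_carrier[OF unit_closed] by simp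
qed

lemma dim_pos: "d > 0"
proof (rule ccontr)
  assume "\<not> d > 0"
  then have "\<phi> e = \<phi> 0" using \<phi>_unit \<phi>_zero by auto
  then show False using \<phi>_inj unit_nonzero unit_closed zero_closed by blast
qed

lemma \<phi>_sum_index:
  assumes "\<And>k. k \<in> I \<Longrightarrow> f k \<in> C" "i < d" "j < d"
  shows "\<phi> (sum f I) $$ (i, j) = (\<Sum>k\<in>I. \<phi> (f k) $$ (i, j))"
  using assms(1)
  by (induction I rule: infinite_finite_induct)
    (use assms(2,3) in \<open>auto simp: \<phi>_zero \<phi>_add sum_closed\<close>)

definition tr :: "'a \<Rightarrow> complex" where
  "tr x = mat_trace (\<phi> x)"

lemma tr_zero: "tr 0 = 0"
  by (simp add: tr_def \<phi>_zero mat_trace_def)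

lemma tr_add: "\<lbrakk>x \<in> C; y \<in> C\<rbrakk> \<Longrightarrow> tr (x + y) = tr x + tr y"
  by (simp add: tr_def \<phi>_add mat_trace_add[OF \<phi>_carrier \<phi>_carrier])

lemma tr_scaleC: "x \<in> C \<Longrightarrow> tr (c *\<^sub>C x) = c * tr x"
  by (simp add: tr_def \<phi>_scaleC mat_trace_smult[OF \<phi>_carrier])

lemma tr_sum: "(\<And>k. k \<in> I \<Longrightarrow> f k \<in> C) \<Longrightarrow> tr (sum f I) = (\<Sum>k\<in>I. tr (f k))"
  by (induction I rule: infinite_finite_induct) (auto simp: tr_zero tr_add sum_closed)

lemma tr_mult_comm: "\<lbrakk>x \<in> C; y \<in> C\<rbrakk> \<Longrightarrow> tr (x * y) = tr (y * x)"
  by (simp add: tr_def \<phi>_mult mat_trace_mult_comm[OF \<phi>_carrier \<phi>_carrier])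

lemma tr_unit: "tr e = of_nat d"
  by (simp add: tr_def \<phi>_unit mat_trace_def)

text \<open>The squared Hilbert-Schmidt norm. Applied to a projection, it shows that the trace is
  real and nonnegative, and positive unless the projection is zero.\<close>

lemma tr_star_mult_self:
  assumes "x \<in> C"
  shows "tr (star x * x) = of_real (\<Sum>i<d. \<Sum>j<d. (cmod (\<phi> x $$ (j, i)))\<^sup>2)"
  using assms mat_trace_adjoint_mult[OF \<phi>_carrier[OF assms]]
  by (simp add: tr_def \<phi>_mult \<phi>_star star_closed)

lemma Re_tr_star_mult_self_nonneg: "x \<in> C \<Longrightarrow> Re (tr (star x * x)) \<ge> 0"
  by (auto simp: tr_star_mult_self simp del: of_real_sum intro!: sum_nonneg)

lemma Re_tr_star_mult_self_pos:
  assumes "x \<in> C" "x \<noteq> 0"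
  shows "Re (tr (star x * x)) > 0"
proof -
  have "\<phi> x \<noteq> 0\<^sub>m d d" using assms \<phi>_inj zero_closed \<phi>_zero by metis
  then obtain i j where ij: "i < d" "j < d" "\<phi> x $$ (j, i) \<noteq> 0"
    using assms by (metis eq_matI \<phi>_dim index_zero_mat)
  have "(\<Sum>i<d. \<Sum>j<d. (cmod (\<phi> x $$ (j, i)))\<^sup>2) > 0"
    using ij by (intro sum_pos2[of _ i] sum_nonneg sum_pos2[of _ j]) auto
  then show ?thesis using assms by (simp add: tr_star_mult_self del: of_real_sum)
qed

section \<open>Matrix units and uniqueness of the trace\<close>

definition munit :: "nat \<Rightarrow> nat \<Rightarrow> 'a" where
  "munit i j = inv_into C \<phi> (mat d d (\<lambda>(k, l). if k = i \<and> l = j then 1 else 0))"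

lemma munit_closed: "munit i j \<in> C"
  unfolding munit_def by (rule inv_\<phi>_closed) simp

lemma \<phi>_munit: "\<phi> (munit i j) = mat d d (\<lambda>(k, l). if k = i \<and> l = j then 1 else 0)"
  unfolding munit_def by (rule \<phi>_inv_\<phi>) simp

lemma star_munit: "star (munit i j) = munit j i"
proof (rule \<phi>_inj)
  show "\<phi> (star (munit i j)) = \<phi> (munit j i)"
    unfolding \<phi>_star[OF munit_closed] \<phi>_munit by (rule eq_matI) auto
qed (simp_all add: munit_closed star_closed)

lemma sum_munit: "(\<Sum>i<d. munit i i) = e"
proof (rule \<phi>_inj)
  show "\<phi> (\<Sum>i<d. munit i i) = \<phi> e"
    by (rule eq_matI) (auto simp: \<phi>_sum_index munit_closed \<phi>_unit \<phi>_munit closed unit_closed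
        sum.delta if_distrib cong: if_cong)
qed (auto simp: closed munit_closed)

text \<open>Matrix units read off single entries inside the algebra. The outer indices
  \<open>k\<close> and \<open>l\<close> are free, since a matrix unit with an index out of range is
  zero.\<close>

lemma munit_sandwich:
  assumes "x \<in> C" "i < d" "j < d"
  shows "munit k i * x * munit j l = \<phi> x $$ (i, j) *\<^sub>C munit k l"
proof (rule \<phi>_inj)
  have "\<phi> (munit k i) * \<phi> x = mat d d (\<lambda>(a, b). if a = k then \<phi> x $$ (i, b) else 0)"
    using assms by (intro eq_matI) (auto simp: \<phi>_munit scalar_prod_def if_distrib[of "\<lambda>c. c * _"] cong: if_cong)
  then show "\<phi> (munit k i * x * munit j l) = \<phi> (\<phi> x $$ (i, j) *\<^sub>C munit k l)"
    using assms by (simp add: \<phi>_mult \<phi>_scaleC munit_closed closed)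
      (intro eq_matI, auto simp: \<phi>_munit scalar_prod_def sum.delta' if_distrib cong: if_cong)
qed (auto simp: closed munit_closed assms)

lemma munit_mult:
  assumes "i < d" "j < d"
  shows "munit k i * munit j l = (if i = j then munit k l else 0)"
proof -
  have "munit k i * munit j l = munit k i * e * munit j l" by (simp add: munit_closed unit_right)
  then show ?thesis using assms munit_sandwich[OF unit_closed, of i j k l] by (simp add: \<phi>_unit)
qed

lemma tracial_functional_unique:
  assumes add: "\<And>x y. \<lbrakk>x \<in> C; y \<in> C\<rbrakk> \<Longrightarrow> \<tau> (x + y) = \<tau> x + \<tau> y"
    and scale: "\<And>x c. x \<in> C \<Longrightarrow> \<tau> (c *\<^sub>C x) = c * (\<tau> x :: complex)"
    and comm: "\<And>x y. \<lbrakk>x \<in> C; y \<in> C\<rbrakk> \<Longrightarrow> \<tau> (x * y) = \<tau> (y * x)"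
  shows "\<exists>c. \<forall>x\<in>C. \<tau> x = c * tr x"
proof (intro exI ballI)
  fix x assume x: "x \<in> C"
  have sum: "\<tau> (sum f I) = (\<Sum>k\<in>I. \<tau> (f k))" if "\<And>k. k \<in> I \<Longrightarrow> f k \<in> C" for f and I :: "nat set"
    using that scale[OF zero_closed, of 0]
    by (induction I rule: infinite_finite_induct) (auto simp: add sum_closed)
  have "\<tau> x = \<tau> (\<Sum>i<d. x * munit i i)"
    using x by (simp add: sum_distrib_left[symmetric] sum_munit unit_right)
  also have "\<dots> = (\<Sum>i<d. \<tau> (x * munit i i))"
    by (rule sum) (simp add: closed munit_closed x)
  also have "\<dots> = (\<Sum>i<d. \<tau> (munit 0 0) * \<phi> x $$ (i, i))"
  proof (rule sum.cong)
    fix i assume "i \<in> {..<d}"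
    then have i: "i < d" by simp
    \<comment> \<open>Every diagonal unit is routed through index 0, which exists because
      \<open>d > 0\<close>. Cyclicity then compresses \<open>x\<close> to its (i, i) entry times
      \<open>munit 0 0\<close>, so the proportionality constant is the value at
      \<open>munit 0 0\<close>.\<close>
    have "x * munit i i = (x * munit i 0) * munit 0 i"
      using i munit_mult[of 0 0 i i] dim_pos by (simp add: mult.assoc)
    then have "\<tau> (x * munit i i) = \<tau> (munit 0 i * x * munit i 0)"
      using comm[of "x * munit i 0" "munit 0 i"] x by (simp add: closed munit_closed mult.assoc)
    then show "\<tau> (x * munit i i) = \<tau> (munit 0 0) * \<phi> x $$ (i, i)"
      using munit_sandwich[OF x i i] by (simp add: scale munit_closed)
  qed simp
  also have "\<dots> = \<tau> (munit 0 0) * tr x"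
    using x by (simp add: tr_def mat_trace_def sum_distrib_left)
  finally show "\<tau> x = \<tau> (munit 0 0) * tr x" .
qed

section \<open>Spectral theorem for self-adjoint elements of a corner\<close>

text \<open>\<open>M\<close> is an upper triangular form of \<open>\<phi> r\<close>; the induction peels off its diagonal
  entries from the bottom. Self-adjointness excludes both nonreal diagonal entries and
  nontrivial Jordan blocks.\<close>

lemma sum_of_eigenvectors:
  assumes r: "r \<in> C" "star r = r"
    and sim: "similar_mat_wit (\<phi> r) M V V'" and tri: "upper_triangular M"
    and "k \<le> d" "w \<in> C"
    and "\<And>i j. \<lbrakk>k \<le> i; i < d; j < d\<rbrakk> \<Longrightarrow> (V' * \<phi> w) $$ (i, j) = 0"
  shows "\<exists>S f. finite S \<and> (\<forall>\<mu>\<in>S. f \<mu> \<in> C \<and> r * f \<mu> = complex_of_real \<mu> *\<^sub>C f \<mu>) \<and> w = sum f S"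
  using assms(5-)
proof (induction k arbitrary: w)
  note V = similar_mat_witD2[OF \<phi>_carrier[OF r(1)] sim]
  case 0
  have "V' * \<phi> w = 0\<^sub>m d d"
    using 0 V \<phi>_carrier[OF 0(2)] by (intro eq_matI) auto
  moreover have "\<phi> w = V * (V' * \<phi> w)"
    using V \<phi>_carrier[OF 0(2)] assoc_mult_mat[of V d d V' d "\<phi> w" d] by simp
  ultimately have "\<phi> w = \<phi> 0" using V \<phi>_zero by simp
  then have "w = 0" using \<phi>_inj 0 zero_closed by blast
  then show ?case by (intro exI[of _ "{}"]) auto
next
  note V = similar_mat_witD2[OF \<phi>_carrier[OF r(1)] sim]
  case (Suc k w)
  have w: "w \<in> C" by fact
  have kd: "k < d" using Suc by simp
  define c where "c = M $$ (k, k)"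
  \<comment> \<open>Applying r - c clears one more row: row \<open>k\<close> of M - c vanishes up to
    and including the diagonal, and the rows of \<open>X\<close> below \<open>k\<close> are already
    zero. Hence the induction hypothesis applies to \<open>u\<close>.\<close>
  define u where "u = r * w + (- c) *\<^sub>C w"
  have u: "u \<in> C" using r w by (simp add: u_def closed)
  have carr: "\<phi> w \<in> carrier_mat d d" "\<phi> r \<in> carrier_mat d d" using \<phi>_carrier w r by auto
  have V'R: "V' * \<phi> r = M * V'"
  proof -
    have "V' * \<phi> r = V' * (V * (M * V'))" using V by simp
    also have "\<dots> = V' * V * (M * V')" using V by (intro assoc_mult_mat[symmetric]) auto
    finally show ?thesis using V by simp
  qed
  define X where "X = V' * \<phi> w"
  have X: "X \<in> carrier_mat d d" using V carr unfolding X_def by simp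
  have "\<phi> u = \<phi> r * \<phi> w + (- c) \<cdot>\<^sub>m \<phi> w"
    unfolding u_def by (simp add: \<phi>_add \<phi>_mult \<phi>_scaleC closed r(1) w)
  then have "V' * \<phi> u = V' * (\<phi> r * \<phi> w) + V' * ((- c) \<cdot>\<^sub>m \<phi> w)"
    using mult_add_distrib_mat[OF V(7) mult_carrier_mat[OF carr(2,1)] smult_carrier_mat[OF carr(1)]]
    by simp
  also have "V' * (\<phi> r * \<phi> w) = M * X"
    using assoc_mult_mat[OF V(7) carr(2,1)] assoc_mult_mat[OF V(5,7) carr(1)] V'R
    unfolding X_def by simp
  also have "V' * ((- c) \<cdot>\<^sub>m \<phi> w) = (- c) \<cdot>\<^sub>m X"
    unfolding X_def by (rule mult_smult_distrib[OF V(7) carr(1)])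
  finally have V'u: "V' * \<phi> u = M * X + (- c) \<cdot>\<^sub>m X" .
  have "(V' * \<phi> u) $$ (i, j) = 0" if ij: "k \<le> i" "i < d" "j < d" for i j
  proof -
    have X0: "X $$ (l, j) = 0" if "Suc k \<le> l" "l < d" for l
      using Suc.prems(3) that ij unfolding X_def by blast
    have "(M * X) $$ (i, j) = (\<Sum>l<d. M $$ (i, l) * X $$ (l, j))"
      using V X ij by (auto simp: scalar_prod_def lessThan_atLeast0)
    also have "\<dots> = (\<Sum>l<d. if l = i then c * X $$ (i, j) else 0)"
    proof (rule sum.cong)
      fix l assume "l \<in> {..<d}"
      then have l: "l < d" by simp
      show "M $$ (i, l) * X $$ (l, j) = (if l = i then c * X $$ (i, j) else 0)"
      proof (cases l i rule: linorder_cases)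
        case less
        then have "M $$ (i, l) = 0" using upper_triangularD[OF tri] ij V by auto
        then show ?thesis using less by simp
      next
        case equal
        then show ?thesis using X0 ij by (cases "i = k") (auto simp: c_def)
      next
        case greater
        then show ?thesis using X0 ij l by auto
      qed
    qed simp
    also have "\<dots> = c * X $$ (i, j)" using ij by simp
    finally show ?thesis unfolding V'u using ij V X by simp
  qed
  then obtain S f where S: "finite S" "\<And>\<mu>. \<mu> \<in> S \<Longrightarrow> f \<mu> \<in> C"
      "\<And>\<mu>. \<mu> \<in> S \<Longrightarrow> r * f \<mu> = complex_of_real \<mu> *\<^sub>C f \<mu>" and u_sum: "u = sum f S"
    using Suc.IH[OF _ u] kd by (metis less_imp_le)
  \<comment> \<open>The components of \<open>u\<close> with eigenvalue different from
    \<open>c\<close> are divided by \<mu> - c and subtracted from \<open>w\<close>. What remains,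
    \<open>w'\<close>, satisfies (r - c) w' = v, where \<open>v\<close> is the part of
    \<open>u\<close> with eigenvalue \<open>c\<close>, so that (r - c) annihilates \<open>w'\<close>
    after two applications.\<close>
  define S' where "S' = {\<mu> \<in> S. complex_of_real \<mu> \<noteq> c}"
  define g where "g \<mu> = inverse (complex_of_real \<mu> - c) *\<^sub>C f \<mu>" for \<mu>
  define w' where "w' = w - sum g S'"
  define v where "v = r * w' - c *\<^sub>C w'"
  have S': "finite S'" "S' \<subseteq> S" using S by (auto simp: S'_def)
  have g: "g \<mu> \<in> C" "r * g \<mu> = complex_of_real \<mu> *\<^sub>C g \<mu>" if "\<mu> \<in> S'" for \<mu>
    using that S S' by (auto simp: g_def closed scaleC_mult_right scaleC_scaleC mult.commute)
  have w': "w' \<in> C" using w g by (auto simp: w'_def closed)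
  have "v = u - (\<Sum>\<mu>\<in>S'. r * g \<mu> - c *\<^sub>C g \<mu>)"
    by (simp add: v_def u_def w'_def algebra_simps scaleC_diff_right scaleC_minus_left
        sum_distrib_left scaleC_sum_right sum_subtractf)
  also have "(\<Sum>\<mu>\<in>S'. r * g \<mu> - c *\<^sub>C g \<mu>) = sum f S'"
  proof (rule sum.cong)
    fix \<mu> assume "\<mu> \<in> S'"
    then show "r * g \<mu> - c *\<^sub>C g \<mu> = f \<mu>"
      using g by (simp add: scaleC_diff_left[symmetric]) (simp add: g_def scaleC_scaleC S'_def)
  qed simp
  also have "u - sum f S' = sum f (S - S')"
    using u_sum S S' by (simp add: sum_diff)
  finally have v: "v = sum f (S - S')" .
  have rv: "r * v = c *\<^sub>C v"
    unfolding v sum_distrib_left scaleC_sum_right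
    by (rule sum.cong) (auto simp: S S'_def)
  have w_eq: "w = w' + sum g S'" by (simp add: w'_def)
  show ?case
  proof (cases "cnj c = c")
    case True
    then obtain \<gamma> where \<gamma>: "c = complex_of_real \<gamma>"
      by (metis Reals_cnj_iff Reals_cases)
    have shift: "(r - c *\<^sub>C 1) * x = r * x - c *\<^sub>C x" for x
      by (simp add: left_diff_distrib scaleC_mult_left)
    have "(r - c *\<^sub>C 1) * ((r - c *\<^sub>C 1) * w') = 0"
      using rv by (simp add: shift v_def[symmetric] del: mult_zero_right)
    then have "(r - c *\<^sub>C 1) * w' = 0"
      by (rule selfadjoint_kernel_square[rotated]) (use r True in \<open>simp add: star_diff star_scaleC\<close>)
    then have "r * w' = complex_of_real \<gamma> *\<^sub>C w'"
      using shift[of w'] by (simp add: \<gamma>)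
    moreover have "\<gamma> \<notin> S'" by (simp add: S'_def \<gamma>)
    moreover have "sum (g(\<gamma> := w')) S' = sum g S'"
      using \<open>\<gamma> \<notin> S'\<close> by (intro sum.cong) auto
    ultimately show ?thesis using S' g w' w_eq
      by (intro exI[of _ "insert \<gamma> S'"] exI[of _ "g(\<gamma> := w')"]) auto
  next
    case False
    \<comment> \<open>The components of \<open>u\<close> have real eigenvalues, so for nonreal
      \<open>c\<close> all of them are divided out and \<open>v\<close> is zero. Then
      \<open>w'\<close> is an eigenelement with a nonreal eigenvalue and must vanish.\<close>
    then have "complex_of_real \<mu> \<noteq> c" for \<mu> by auto
    then have "S - S' = {}" by (auto simp: S'_def)
    then have "v = 0" using v by (metis sum.empty)
    then have "r * w' = c *\<^sub>C w'" by (simp add: v_def)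
    then have "w' = 0" using False selfadjoint_eigenvalue_real r by blast
    then show ?thesis using S' g w_eq
      by (intro exI[of _ S'] exI[of _ g]) auto
  qed
qed

text \<open>The unit \<open>e\<close> itself is decomposed into eigenelements. Components for
  different eigenvalues satisfy \<open>star (E \<mu>) * E \<nu> = 0\<close>, so multiplying
  \<open>star e = e\<close> by \<open>E \<mu>\<close> leaves
  \<open>E \<mu> = star (E \<mu>) * E \<mu>\<close>; this makes every component a self-adjoint
  idempotent. Setting \<open>E\<close> to zero off \<open>S\<close> gives a family indexed by all
  reals.\<close>

lemma spectral_resolution_exists:
  assumes r: "r \<in> C" "star r = r"
  shows "\<exists>S E. finite S \<and> (\<forall>\<mu>. E \<mu> \<in> C \<and> star (E \<mu>) = E \<mu> \<and> E \<mu> * E \<mu> = E \<mu> \<and>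
      r * E \<mu> = complex_of_real \<mu> *\<^sub>C E \<mu> \<and> (\<forall>\<nu>. \<mu> \<noteq> \<nu> \<longrightarrow> E \<mu> * E \<nu> = 0) \<and>
      (\<mu> \<notin> S \<longrightarrow> E \<mu> = 0)) \<and> sum E S = e"
proof -
  obtain as where as: "char_poly (\<phi> r) = (\<Prod>a\<leftarrow>as. [:- a, 1:])"
    using char_poly_factorized[OF \<phi>_carrier[OF r(1)]] by blast
  obtain M V V' where "schur_decomposition (\<phi> r) as = (M, V, V')"
    by (metis prod_cases3)
  then have M: "similar_mat_wit (\<phi> r) M V V'" "upper_triangular M"
    using schur_decomposition[OF \<phi>_carrier[OF r(1)] as] by auto
  obtain S f where S: "finite S" "\<And>\<mu>. \<mu> \<in> S \<Longrightarrow> f \<mu> \<in> C"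
      "\<And>\<mu>. \<mu> \<in> S \<Longrightarrow> r * f \<mu> = complex_of_real \<mu> *\<^sub>C f \<mu>" and e_sum: "e = sum f S"
    using sum_of_eigenvectors[OF r M order_refl unit_closed] by auto
  define E where "E \<mu> = (if \<mu> \<in> S then f \<mu> else 0)" for \<mu>
  have E: "E \<mu> \<in> C" "r * E \<mu> = complex_of_real \<mu> *\<^sub>C E \<mu>" for \<mu>
    using S by (auto simp: E_def closed)
  have E_sum: "sum E S = e" unfolding e_sum by (rule sum.cong) (auto simp: E_def)
  have orth: "star (E \<mu>) * E \<nu> = 0" if "\<mu> \<noteq> \<nu>" for \<mu> \<nu>
  proof -
    have "star (E \<mu>) * (r * E \<nu>) = complex_of_real \<nu> *\<^sub>C (star (E \<mu>) * E \<nu>)"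
      by (simp add: E scaleC_mult_right)
    moreover have "star (r * E \<mu>) * E \<nu> = complex_of_real \<mu> *\<^sub>C (star (E \<mu>) * E \<nu>)"
      by (simp add: E(2) star_scaleC scaleC_mult_left)
    moreover have "star (r * E \<mu>) * E \<nu> = star (E \<mu>) * (r * E \<nu>)"
      by (simp add: star_mult r mult.assoc)
    ultimately show ?thesis using that scaleC_right_cancel by (metis of_real_eq_iff)
  qed
  have sq: "E \<mu> = star (E \<mu>) * E \<mu>" for \<mu>
  proof (cases "\<mu> \<in> S")
    case True
    have "E \<mu> = star (sum E S) * E \<mu>" using E by (simp add: E_sum star_unit unit_left)
    also have "\<dots> = (\<Sum>\<nu>\<in>S. star (E \<nu>) * E \<mu>)" by (simp add: star_sum sum_distrib_right)
    also have "\<dots> = (\<Sum>\<nu>\<in>S. if \<nu> = \<mu> then star (E \<mu>) * E \<mu> else 0)"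
      by (rule sum.cong) (auto simp: orth)
    finally show ?thesis using True S by simp
  qed (simp add: E_def)
  have star_E: "star (E \<mu>) = E \<mu>" for \<mu>
    by (metis sq star_mult star_star)
  show ?thesis
    using S E E_sum orth sq star_E
    by (intro exI[of _ S] exI[of _ E]) (auto simp: E_def)
qed

text \<open>A vector is encoded as the algebra element all of whose columns equal it. Equations
  between matrix-vector products thereby become equations in the algebra.\<close>

definition const_cols :: "complex vec \<Rightarrow> 'a" where
  "const_cols v = inv_into C \<phi> (mat d d (\<lambda>(i, j). v $ i))"

lemma const_cols_closed: "const_cols v \<in> C"
  unfolding const_cols_def by (rule inv_\<phi>_closed) simp

lemma \<phi>_mult_const_cols:
  assumes "x \<in> C" "v \<in> carrier_vec d"
  shows "\<phi> (x * const_cols v) = mat d d (\<lambda>(i, j). (\<phi> x *\<^sub>v v) $ i)"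
proof -
  have "\<phi> (const_cols v) = mat d d (\<lambda>(i, j). v $ i)"
    unfolding const_cols_def by (rule \<phi>_inv_\<phi>) simp
  then show ?thesis
    using assms by (auto simp: \<phi>_mult const_cols_closed scalar_prod_def intro!: eq_matI)
qed

lemma mult_const_cols_eq_iff:
  assumes "x \<in> C" "y \<in> C" "v \<in> carrier_vec d"
  shows "x * const_cols v = y * const_cols v \<longleftrightarrow> \<phi> x *\<^sub>v v = \<phi> y *\<^sub>v v"
proof
  assume "x * const_cols v = y * const_cols v"
  then have eq: "mat d d (\<lambda>(i, j). (\<phi> x *\<^sub>v v) $ i) = mat d d (\<lambda>(i, j). (\<phi> y *\<^sub>v v) $ i)"
    using \<phi>_mult_const_cols assms by metis
  show "\<phi> x *\<^sub>v v = \<phi> y *\<^sub>v v"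
  proof (rule eq_vecI)
    fix i assume "i < dim_vec (\<phi> y *\<^sub>v v)"
    then show "(\<phi> x *\<^sub>v v) $ i = (\<phi> y *\<^sub>v v) $ i"
      using assms arg_cong[OF eq, of "\<lambda>A. A $$ (i, 0)"] dim_pos by (simp del: index_mult_mat_vec)
  qed (use assms in auto)
next
  assume "\<phi> x *\<^sub>v v = \<phi> y *\<^sub>v v"
  then show "x * const_cols v = y * const_cols v"
    using assms by (intro \<phi>_inj) (auto simp: \<phi>_mult_const_cols closed const_cols_closed)
qed

definition spec :: "'a \<Rightarrow> real set" where
  "spec r = {\<gamma>. eigenvalue (\<phi> r) (complex_of_real \<gamma>)}"

definition eigproj :: "'a \<Rightarrow> real \<Rightarrow> 'a" where
  "eigproj r \<gamma> = inv_into C \<phi> (eigenspace_projection (\<phi> r) \<gamma>)"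

text \<open>The abstract family \<open>E\<close> is matched with the definite description behind
  \<open>eigproj\<close>: the fixed vectors of \<open>E \<gamma>\<close> are exactly the
  eigenvectors for \<gamma>. Indeed, if \<open>x\<close> is an eigenelement for \<gamma>, then
  \<open>E \<mu> * (r * x)\<close> is both \<mu> and \<gamma> times \<open>E \<mu> * x\<close>, so
  only the component at \<gamma> survives.\<close>

lemma spectral_resolution:
  assumes r: "r \<in> C" "star r = r"
  shows finite_spec: "finite (spec r)"
    and eigproj_closed: "eigproj r \<gamma> \<in> C"
    and star_eigproj: "star (eigproj r \<gamma>) = eigproj r \<gamma>"
    and eigproj_idem: "eigproj r \<gamma> * eigproj r \<gamma> = eigproj r \<gamma>"
    and mult_eigproj: "r * eigproj r \<gamma> = complex_of_real \<gamma> *\<^sub>C eigproj r \<gamma>"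
    and eigproj_orth: "\<gamma> \<noteq> \<delta> \<Longrightarrow> eigproj r \<gamma> * eigproj r \<delta> = 0"
    and eigproj_eq_0_iff: "eigproj r \<gamma> = 0 \<longleftrightarrow> \<gamma> \<notin> spec r"
    and sum_eigproj: "sum (eigproj r) (spec r) = e"
proof -
  obtain S E where S: "finite S" and E: "\<And>\<mu>. E \<mu> \<in> C" "\<And>\<mu>. star (E \<mu>) = E \<mu>"
      "\<And>\<mu>. E \<mu> * E \<mu> = E \<mu>" "\<And>\<mu>. r * E \<mu> = complex_of_real \<mu> *\<^sub>C E \<mu>"
      "\<And>\<mu> \<nu>. \<mu> \<noteq> \<nu> \<Longrightarrow> E \<mu> * E \<nu> = 0" "\<And>\<mu>. \<mu> \<notin> S \<Longrightarrow> E \<mu> = 0" and E_sum: "sum E S = e"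
    using spectral_resolution_exists[OF r] by blast
  have Er: "E \<mu> * r = complex_of_real \<mu> *\<^sub>C E \<mu>" for \<mu>
    using arg_cong[OF E(4)[of \<mu>], of star] by (simp add: star_mult star_scaleC E(2) r(2))
  have range: "\<phi> (E \<gamma>) *\<^sub>v v = v \<longleftrightarrow> \<phi> r *\<^sub>v v = complex_of_real \<gamma> \<cdot>\<^sub>v v"
    if v: "v \<in> carrier_vec d" for \<gamma> v
  proof -
    define x where "x = const_cols v"
    have x: "x \<in> C" by (simp add: x_def const_cols_closed)
    have "\<phi> (E \<gamma>) *\<^sub>v v = v \<longleftrightarrow> E \<gamma> * x = e * x"
      using v E mult_const_cols_eq_iff[of "E \<gamma>" e v] unit_closed by (simp add: \<phi>_unit x_def)
    moreover have "\<phi> r *\<^sub>v v = complex_of_real \<gamma> \<cdot>\<^sub>v v \<longleftrightarrow> r * x = (complex_of_real \<gamma> *\<^sub>C e) * x"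
      using v r mult_const_cols_eq_iff[of r "complex_of_real \<gamma> *\<^sub>C e" v] unit_closed
        smult_unit_mult_vec[OF v]
      by (simp add: \<phi>_unit x_def \<phi>_scaleC closed)
    moreover have "E \<gamma> * x = x \<longleftrightarrow> r * x = complex_of_real \<gamma> *\<^sub>C x"
    proof
      assume "E \<gamma> * x = x"
      then show "r * x = complex_of_real \<gamma> *\<^sub>C x"
        using E(4)[of \<gamma>] by (metis mult.assoc scaleC_mult_left)
    next
      assume rx: "r * x = complex_of_real \<gamma> *\<^sub>C x"
      have off: "E \<mu> * x = 0" if "\<mu> \<noteq> \<gamma>" for \<mu>
      proof -
        have "complex_of_real \<mu> *\<^sub>C (E \<mu> * x) = complex_of_real \<gamma> *\<^sub>C (E \<mu> * x)"
          using Er[of \<mu>] rx by (metis mult.assoc scaleC_mult_left scaleC_mult_right)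
        then show ?thesis using scaleC_right_cancel that by (metis of_real_eq_iff)
      qed
      have "x = sum E S * x" using x by (simp add: E_sum unit_left)
      also have "\<dots> = (\<Sum>\<mu>\<in>S. if \<mu> = \<gamma> then E \<gamma> * x else 0)"
        unfolding sum_distrib_right by (rule sum.cong) (auto simp: off)
      also have "\<dots> = E \<gamma> * x" using S E(6) by auto
      finally show "E \<gamma> * x = x" ..
    qed
    ultimately show ?thesis using x by (simp add: scaleC_mult_left unit_left)
  qed
  have "eigenspace_projection (\<phi> r) \<gamma> = \<phi> (E \<gamma>)" for \<gamma>
    unfolding eigenspace_projection_def \<phi>_dim(1)[OF r(1)]
  proof (rule the_equality)
    show proj: "\<phi> (E \<gamma>) \<in> carrier_mat d d \<and> mat_adjoint (\<phi> (E \<gamma>)) = \<phi> (E \<gamma>) \<and>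
        \<phi> (E \<gamma>) * \<phi> (E \<gamma>) = \<phi> (E \<gamma>) \<and>
        (\<forall>v\<in>carrier_vec d. \<phi> (E \<gamma>) *\<^sub>v v = v \<longleftrightarrow> \<phi> r *\<^sub>v v = complex_of_real \<gamma> \<cdot>\<^sub>v v)"
      using E range \<phi>_carrier by (simp flip: \<phi>_mult \<phi>_star)
    fix Q
    assume "Q \<in> carrier_mat d d \<and> mat_adjoint Q = Q \<and> Q * Q = Q \<and>
        (\<forall>v\<in>carrier_vec d. Q *\<^sub>v v = v \<longleftrightarrow> \<phi> r *\<^sub>v v = complex_of_real \<gamma> \<cdot>\<^sub>v v)"
    then show "Q = \<phi> (E \<gamma>)"
      using proj by (intro orthogonal_projection_unique[of Q d]) auto
  qed
  then have eq: "eigproj r = E"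
    using \<phi>_bij E by (auto simp: eigproj_def bij_betw_def)
  show "eigproj r \<gamma> \<in> C" "star (eigproj r \<gamma>) = eigproj r \<gamma>"
    "eigproj r \<gamma> * eigproj r \<gamma> = eigproj r \<gamma>"
    "r * eigproj r \<gamma> = complex_of_real \<gamma> *\<^sub>C eigproj r \<gamma>"
    "\<gamma> \<noteq> \<delta> \<Longrightarrow> eigproj r \<gamma> * eigproj r \<delta> = 0"
    unfolding eq using E by auto
  have spec: "eigproj r \<gamma> = 0 \<longleftrightarrow> \<gamma> \<notin> spec r" for \<gamma>
  proof -
    have "\<gamma> \<in> spec r \<longleftrightarrow> (\<exists>v\<in>carrier_vec d. v \<noteq> 0\<^sub>v d \<and> \<phi> (E \<gamma>) *\<^sub>v v = v)"
      using range r by (auto simp: spec_def eigenvalue_def eigenvector_def)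
    also have "\<dots> \<longleftrightarrow> E \<gamma> \<noteq> 0"
    proof
      assume "\<exists>v\<in>carrier_vec d. v \<noteq> 0\<^sub>v d \<and> \<phi> (E \<gamma>) *\<^sub>v v = v"
      moreover have "0\<^sub>m d d *\<^sub>v v = 0\<^sub>v d" if "v \<in> carrier_vec d" for v :: "complex vec"
        using that by (intro eq_vecI) auto
      ultimately show "E \<gamma> \<noteq> 0" using \<phi>_zero by auto
    next
      assume "E \<gamma> \<noteq> 0"
      then have "\<phi> (E \<gamma>) \<noteq> 0\<^sub>m d d" using \<phi>_inj E zero_closed \<phi>_zero by metis
      then obtain j where j: "j < d" "col (\<phi> (E \<gamma>)) j \<noteq> 0\<^sub>v d"
        using E by (metis mat_col_eqI \<phi>_dim col_zero index_zero_mat(2,3))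
      have "\<phi> (E \<gamma>) *\<^sub>v col (\<phi> (E \<gamma>)) j = col (\<phi> (E \<gamma>)) j"
        using j col_mult2[OF \<phi>_carrier \<phi>_carrier, of "E \<gamma>" "E \<gamma>" j] E \<phi>_mult[of "E \<gamma>" "E \<gamma>"] by simp
      then show "\<exists>v\<in>carrier_vec d. v \<noteq> 0\<^sub>v d \<and> \<phi> (E \<gamma>) *\<^sub>v v = v"
        using j E by (intro bexI[of _ "col (\<phi> (E \<gamma>)) j"]) (auto intro: carrier_vecI)
    qed
    finally show ?thesis by (simp add: eq)
  qed
  then show "eigproj r \<gamma> = 0 \<longleftrightarrow> \<gamma> \<notin> spec r" .
  have sub: "spec r \<subseteq> S" using spec E(6) eq by auto
  then show "finite (spec r)" using S finite_subset by blast
  show "sum (eigproj r) (spec r) = e"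
    using sub S spec eq E_sum by (metis DiffD2 sum.mono_neutral_left)
qed

end

section \<open>Weights\<close>

lemma cis_family_inj:
  assumes "\<And>t. exp (\<i> * complex_of_real t * complex_of_real a) = exp (\<i> * complex_of_real t * complex_of_real b)"
  shows "a = b"
proof (rule ccontr)
  assume "a \<noteq> b"
  \<comment> \<open>At this time the two exponents differ by i pi, so the exponentials are negatives
    of each other.\<close>
  define t where "t = pi / (a - b)"
  have "\<i> * complex_of_real t * complex_of_real a =
      \<i> * complex_of_real t * complex_of_real b + \<i> * complex_of_real pi"
  proof -
    have "t * a = t * b + pi"
      using \<open>a \<noteq> b\<close> by (simp add: t_def field_simps)
    then have "complex_of_real t * complex_of_real a = complex_of_real t * complex_of_real b + complex_of_real pi"
      by (simp flip: of_real_mult of_real_add)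
    then show ?thesis by (simp add: mult.assoc distrib_left)
  qed
  then have "exp (\<i> * complex_of_real t * complex_of_real a) = - exp (\<i> * complex_of_real t * complex_of_real b)"
    by (simp only: exp_add) (simp add: mult.commute)
  with assms[of t] show False by simp
qed

lemma exp_of_real_mult_ln:
  "\<gamma> > 0 \<Longrightarrow> exp (complex_of_real s * complex_of_real (ln \<gamma>)) = complex_of_real (\<gamma> powr s)"
  by (simp add: powr_def flip: exp_of_real of_real_mult)

locale weighted_corner = matrix_corner C e \<phi> d
  for C :: "'a::cstar_algebra set" and e \<phi> d +
  fixes r :: 'a
  assumes weight_positive: "\<exists>y\<in>C. r = star y * y"
    and weight_invertible: "\<exists>\<sigma>\<in>C. \<sigma> * r = e"
begin

lemma weight_closed: "r \<in> C"
  using weight_positive closed by auto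

lemma star_weight: "star r = r"
  using weight_positive by (auto simp: star_mult star_star)

abbreviation pr :: "real \<Rightarrow> 'a" where "pr \<equiv> eigproj r"

lemmas pr_closed = eigproj_closed[OF weight_closed star_weight]
  and star_pr = star_eigproj[OF weight_closed star_weight]
  and pr_idem = eigproj_idem[OF weight_closed star_weight]
  and mult_pr = mult_eigproj[OF weight_closed star_weight]
  and pr_orth = eigproj_orth[OF weight_closed star_weight]
  and pr_eq_0_iff = eigproj_eq_0_iff[OF weight_closed star_weight]
  and sum_pr = sum_eigproj[OF weight_closed star_weight]
  and finite_spec_weight = finite_spec[OF weight_closed star_weight]

lemma tr_pr: "tr (pr \<gamma>) = of_real (Re (tr (pr \<gamma>)))"
  using tr_star_mult_self[OF pr_closed, of \<gamma>] by (simp add: star_pr pr_idem)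

lemma Re_tr_pr_pos: "\<gamma> \<in> spec r \<Longrightarrow> Re (tr (pr \<gamma>)) > 0"
  using Re_tr_star_mult_self_pos[OF pr_closed, of \<gamma>] pr_eq_0_iff by (simp add: star_pr pr_idem)

text \<open>Compressing \<open>r = star y * y\<close> by an eigenprojection gives \<gamma> times
  that projection; its trace is nonnegative, hence so is \<gamma>. Invertibility excludes 0.
  Positivity is what makes \<open>ln\<close> injective on the spectrum.\<close>

lemma spec_pos:
  assumes "\<gamma> \<in> spec r"
  shows "\<gamma> > 0"
proof -
  obtain y where y: "y \<in> C" "r = star y * y" using weight_positive by blast
  have "star (y * pr \<gamma>) * (y * pr \<gamma>) = pr \<gamma> * (r * pr \<gamma>)"
    unfolding star_mult star_pr by (simp only: y(2) mult.assoc)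
  also have "\<dots> = complex_of_real \<gamma> *\<^sub>C pr \<gamma>"
    by (simp add: mult_pr scaleC_mult_right pr_idem)
  finally have "0 \<le> Re (tr (complex_of_real \<gamma> *\<^sub>C pr \<gamma>))"
    using Re_tr_star_mult_self_nonneg[OF mult_closed[OF y(1) pr_closed], of \<gamma>] by simp
  then have "\<gamma> \<ge> 0"
    using Re_tr_pr_pos[OF assms] by (simp add: tr_scaleC pr_closed zero_le_mult_iff)
  moreover have "\<gamma> \<noteq> 0"
  proof
    assume "\<gamma> = 0"
    obtain \<sigma> where \<sigma>: "\<sigma> * r = e" using weight_invertible by blast
    have "pr \<gamma> = \<sigma> * (r * pr \<gamma>)"
      by (simp only: mult.assoc[symmetric] \<sigma> unit_left[OF pr_closed])
    then show False using assms pr_eq_0_iff \<open>\<gamma> = 0\<close> by (simp add: mult_pr)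
  qed
  ultimately show ?thesis by simp
qed

lemma spec_nonempty: "spec r \<noteq> {}"
  using sum_pr unit_nonzero by auto

section \<open>Complex powers of the weight and the flow that they implement\<close>

definition wpow :: "complex \<Rightarrow> 'a" where
  "wpow s = (\<Sum>\<gamma>\<in>spec r. exp (s * complex_of_real (ln \<gamma>)) *\<^sub>C pr \<gamma>)"

lemma wpow_closed: "wpow s \<in> C"
  unfolding wpow_def by (intro sum_closed scaleC_closed pr_closed)

lemma pr_wpow: "pr \<gamma> * wpow s = exp (s * complex_of_real (ln \<gamma>)) *\<^sub>C pr \<gamma>"
proof -
  have "pr \<gamma> * wpow s = (\<Sum>\<delta>\<in>spec r. if \<delta> = \<gamma> then exp (s * complex_of_real (ln \<gamma>)) *\<^sub>C pr \<gamma> else 0)"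
    unfolding wpow_def sum_distrib_left
    by (rule sum.cong) (auto simp: scaleC_mult_right pr_orth pr_idem)
  then show ?thesis using pr_eq_0_iff[of \<gamma>] finite_spec_weight by simp
qed

lemma wpow_pr: "wpow s * pr \<gamma> = exp (s * complex_of_real (ln \<gamma>)) *\<^sub>C pr \<gamma>"
proof -
  have "wpow s * pr \<gamma> = (\<Sum>\<delta>\<in>spec r. if \<delta> = \<gamma> then exp (s * complex_of_real (ln \<gamma>)) *\<^sub>C pr \<gamma> else 0)"
    unfolding wpow_def sum_distrib_right
    by (rule sum.cong) (auto simp: scaleC_mult_left pr_orth pr_idem)
  then show ?thesis using pr_eq_0_iff[of \<gamma>] finite_spec_weight by simp
qed

lemma wpow_add: "wpow s * wpow t = wpow (s + t)"
proof -
  have "wpow s * wpow t = (\<Sum>\<gamma>\<in>spec r. exp (t * complex_of_real (ln \<gamma>)) *\<^sub>C (wpow s * pr \<gamma>))"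
    unfolding wpow_def[of t] by (simp add: sum_distrib_left scaleC_mult_right)
  also have "\<dots> = wpow (s + t)"
    unfolding wpow_pr wpow_def[of "s + t"] scaleC_scaleC
    by (intro sum.cong) (auto simp: distrib_right exp_add mult.commute)
  finally show ?thesis .
qed

lemma wpow_0: "wpow 0 = e"
  by (simp add: wpow_def sum_pr)

lemma star_wpow_imag: "star (wpow (\<i> * complex_of_real t)) = wpow (- (\<i> * complex_of_real t))"
proof -
  have "cnj (exp (\<i> * complex_of_real t * complex_of_real a)) = exp (- (\<i> * complex_of_real t) * complex_of_real a)" for a
    using cis_cnj[of "t * a"] by (simp add: cis_conv_exp mult.assoc)
  then show ?thesis
    unfolding wpow_def star_sum star_scaleC star_pr by simp
qed

definition wflow :: "real \<Rightarrow> 'a \<Rightarrow> 'a" where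
  "wflow t x = wpow (\<i> * complex_of_real t) * x * star (wpow (\<i> * complex_of_real t))"

lemma pr_wflow_pr:
  "pr \<gamma> * wflow t x * pr \<delta> =
    (exp (\<i> * complex_of_real t * complex_of_real (ln \<gamma> - ln \<delta>))) *\<^sub>C (pr \<gamma> * x * pr \<delta>)"
proof -
  have "pr \<gamma> * wflow t x * pr \<delta> =
      (pr \<gamma> * wpow (\<i> * complex_of_real t)) * x * (wpow (- (\<i> * complex_of_real t)) * pr \<delta>)"
    by (simp add: wflow_def star_wpow_imag mult.assoc)
  then show ?thesis
    by (simp add: pr_wpow wpow_pr scaleC_mult_left scaleC_mult_right scaleC_scaleC right_diff_distrib
        mult.commute flip: exp_add)
qed

lemma wflow_pr: "wflow t (pr \<gamma>) = pr \<gamma>"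
proof -
  have "wflow t (pr \<gamma>) = wpow (\<i> * complex_of_real t) * (pr \<gamma> * wpow (- (\<i> * complex_of_real t)))"
    by (simp add: wflow_def star_wpow_imag mult.assoc)
  then show ?thesis
    by (simp add: pr_wpow wpow_pr scaleC_mult_right scaleC_scaleC flip: exp_add)
qed

lemma wflow_unit: "wflow t e = e"
proof -
  have "wflow t e = wpow (\<i> * complex_of_real t) * wpow (- (\<i> * complex_of_real t))"
    by (simp add: wflow_def star_wpow_imag unit_right wpow_closed)
  then show ?thesis by (simp add: wpow_add wpow_0)
qed

text \<open>The flow multiplies the block of \<open>y\<close> between eigenprojections for \<gamma>
  and \<delta> by a character of frequency ln \<gamma> - ln \<delta>. Invariance therefore kills all
  off-diagonal blocks, and both products reduce to the diagonal block at \<gamma>.\<close>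

lemma wflow_fixed_commutes_pr:
  assumes y: "y \<in> C" and "\<And>t. wflow t y = y"
  shows "pr \<gamma> * y = y * pr \<gamma>"
proof (cases "\<gamma> \<in> spec r")
  case True
  have off: "pr \<gamma> * y * pr \<delta> = 0" if "\<gamma> \<noteq> \<delta>" "\<gamma> > 0" "\<delta> > 0" for \<gamma> \<delta>
  proof (rule ccontr)
    assume nz: "pr \<gamma> * y * pr \<delta> \<noteq> 0"
    have "exp (\<i> * complex_of_real t * complex_of_real (ln \<gamma> - ln \<delta>)) =
        exp (\<i> * complex_of_real t * complex_of_real 0)" for t
      using pr_wflow_pr[of \<gamma> t y \<delta>] assms(2)[of t] nz
        scaleC_right_cancel[of 1 "pr \<gamma> * y * pr \<delta>"] by (metis exp_zero mult_zero_right of_real_0 scaleC_1)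
    then have "ln \<gamma> - ln \<delta> = 0" by (rule cis_family_inj)
    with that show False by simp
  qed
  have "pr \<gamma> * y = (\<Sum>\<delta>\<in>spec r. pr \<gamma> * y * pr \<delta>)"
    using y by (simp add: sum_pr unit_right closed pr_closed flip: sum_distrib_left)
  also have "\<dots> = (\<Sum>\<delta>\<in>spec r. if \<delta> = \<gamma> then pr \<gamma> * y * pr \<gamma> else 0)"
    by (rule sum.cong) (auto simp: off spec_pos True)
  also have "\<dots> = (\<Sum>\<delta>\<in>spec r. pr \<delta> * y * pr \<gamma>)"
    using True by (subst sum.delta[OF finite_spec_weight], simp)
      (subst sum.remove[OF finite_spec_weight True], auto intro!: sum.neutral off simp: spec_pos)
  also have "\<dots> = y * pr \<gamma>"
    using y by (simp add: sum_pr unit_left closed pr_closed flip: sum_distrib_right)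
  finally show ?thesis .
next
  case False
  then show ?thesis using pr_eq_0_iff[of \<gamma>] by simp
qed

lemma tr_wpow_real:
  "tr (wpow (complex_of_real s)) = complex_of_real (\<Sum>\<gamma>\<in>spec r. \<gamma> powr s * Re (tr (pr \<gamma>)))"
proof -
  have "tr (wpow (complex_of_real s)) = (\<Sum>\<gamma>\<in>spec r. complex_of_real (\<gamma> powr s) * tr (pr \<gamma>))"
    unfolding wpow_def
    by (subst tr_sum) (auto simp: closed pr_closed tr_scaleC exp_of_real_mult_ln spec_pos)
  also have "\<dots> = (\<Sum>\<gamma>\<in>spec r. complex_of_real (\<gamma> powr s * Re (tr (pr \<gamma>))))"
    by (rule sum.cong) (use tr_pr in auto)
  finally show ?thesis by simp
qed

lemma Re_tr_wpow_real_pos: "Re (tr (wpow (complex_of_real s))) > 0"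
  unfolding tr_wpow_real Re_complex_of_real
  using spec_nonempty finite_spec_weight Re_tr_pr_pos spec_pos
  by (intro sum_pos) (auto intro!: mult_pos_pos dest: spec_pos)

text \<open>This is the situation at the root. A scalar weight \<gamma> whose trace equals that of
  its inverse has \<gamma>\<gamma> = 1, so \<gamma> = 1 by positivity and all powers are the
  unit.\<close>

lemma tr_wpow_scalar_weight:
  assumes r: "r = k *\<^sub>C e" and \<sigma>: "\<sigma> \<in> C" "\<sigma> * r = e" "tr r = tr \<sigma>"
  shows "Re (tr (wpow (complex_of_real s))) = real d"
proof -
  have spec: "k = complex_of_real \<gamma>" if "\<gamma> \<in> spec r" for \<gamma>
  proof -
    have "k *\<^sub>C pr \<gamma> = complex_of_real \<gamma> *\<^sub>C pr \<gamma>"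
      using mult_pr[of \<gamma>] by (simp add: r scaleC_mult_left unit_left eigproj_closed scaleC_closed unit_closed
          pr_closed[unfolded r])
    then show ?thesis using that pr_eq_0_iff scaleC_right_cancel by blast
  qed
  obtain \<gamma> where \<gamma>: "\<gamma> \<in> spec r" using spec_nonempty by blast
  have "\<delta> = \<gamma>" if "\<delta> \<in> spec r" for \<delta>
    using spec[OF \<gamma>] spec[OF that] by simp
  then have spec_r: "spec r = {\<gamma>}" using \<gamma> by blast
  have k\<sigma>: "k *\<^sub>C \<sigma> = e"
    using \<sigma>(1,2) by (simp add: r scaleC_mult_right unit_right)
  have "of_nat d = k * tr \<sigma>"
    using arg_cong[OF k\<sigma>, of tr] by (simp add: tr_scaleC \<sigma>(1) tr_unit)
  also have "tr \<sigma> = k * of_nat d"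
    using \<sigma>(3) tr_scaleC[OF unit_closed, of k] by (simp add: r tr_unit)
  finally have "complex_of_real (real d) = complex_of_real (\<gamma> * \<gamma> * real d)"
    by (simp add: spec[OF \<gamma>])
  then have "\<gamma> * \<gamma> * real d = real d" by (metis of_real_eq_iff)
  then have "\<gamma> * \<gamma> = 1" using dim_pos by simp
  then have "\<gamma> = 1" using spec_pos[OF \<gamma>] square_eq_1_iff[of \<gamma>] by auto
  moreover have "pr \<gamma> = e" using sum_pr spec_r by simp
  ultimately show ?thesis
    unfolding tr_wpow_real spec_r by (simp add: tr_unit)
qed

end

section \<open>Inclusions of weighted corners\<close>

text \<open>Neither corner need contain the other: the embedding of algebras appears as the cut
  \<open>x \<mapsto> e * x\<close>, which may kill elements. The last assumption says that the cut
  intertwines the two flows, both being restrictions of one flow.\<close>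

locale weighted_inclusion =
  up: weighted_corner C e \<phi> d r + low: weighted_corner C' e' \<phi>' d' r'
  for C :: "'a::cstar_algebra set" and e \<phi> d r and C' :: "'a set" and e' \<phi>' d' r' +
  assumes unit_comm: "x \<in> C' \<Longrightarrow> e * x = x * e"
    and cut_closed: "x \<in> C' \<Longrightarrow> e * x \<in> C"
    and cut_wflow: "x \<in> C' \<Longrightarrow> e * low.wflow t x = up.wflow t (e * x)"
begin

lemma mult_low_closed:
  assumes "x \<in> C" "y \<in> C'"
  shows "x * y \<in> C"
proof -
  have "x * y = x * (e * y)" using assms by (simp add: up.unit_right flip: mult.assoc)
  then show ?thesis using assms by (simp add: up.mult_closed cut_closed)
qed

text \<open>A lower eigenprojection is fixed by the lower flow, so its cut is fixed by the upper
  flow and commutes with the upper eigenprojections, which absorb the factor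
  \<open>e\<close>.\<close>

lemma pr_commute: "up.pr \<gamma> * low.pr \<delta> = low.pr \<delta> * up.pr \<gamma>"
proof -
  have "up.pr \<gamma> * (e * low.pr \<delta>) = e * low.pr \<delta> * up.pr \<gamma>"
    using up.wflow_fixed_commutes_pr[of "e * low.pr \<delta>" \<gamma>] cut_wflow[OF low.pr_closed, of _ \<delta>]
    by (simp add: cut_closed low.pr_closed low.wflow_pr)
  then show ?thesis
    using unit_comm[OF low.pr_closed, of \<delta>] up.unit_left[OF up.pr_closed] up.unit_right[OF up.pr_closed]
    by (metis mult.assoc)
qed

section \<open>Joint eigenprojections of the two weights\<close>

definition joint :: "real \<Rightarrow> real \<Rightarrow> 'a" where
  "joint \<gamma> \<delta> = up.pr \<gamma> * low.pr \<delta>"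

lemma joint_closed: "joint \<gamma> \<delta> \<in> C"
  unfolding joint_def by (intro mult_low_closed up.pr_closed low.pr_closed)

lemma star_joint: "star (joint \<gamma> \<delta>) = joint \<gamma> \<delta>"
  by (simp add: joint_def star_mult up.star_pr low.star_pr pr_commute)

lemma joint_idem: "joint \<gamma> \<delta> * joint \<gamma> \<delta> = joint \<gamma> \<delta>"
proof -
  have "joint \<gamma> \<delta> * joint \<gamma> \<delta> = up.pr \<gamma> * (low.pr \<delta> * up.pr \<gamma>) * low.pr \<delta>"
    by (simp add: joint_def mult.assoc)
  also have "\<dots> = (up.pr \<gamma> * up.pr \<gamma>) * (low.pr \<delta> * low.pr \<delta>)"
    by (simp only: pr_commute[symmetric] mult.assoc)
  finally show ?thesis by (simp add: up.pr_idem low.pr_idem joint_def)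
qed

definition joint_tr :: "real \<Rightarrow> real \<Rightarrow> real" where
  "joint_tr \<gamma> \<delta> = Re (up.tr (joint \<gamma> \<delta>))"

lemma tr_joint: "up.tr (joint \<gamma> \<delta>) = complex_of_real (joint_tr \<gamma> \<delta>)"
  using up.tr_star_mult_self[OF joint_closed, of \<gamma> \<delta>] by (simp add: star_joint joint_idem joint_tr_def)

lemma joint_tr_nonneg: "joint_tr \<gamma> \<delta> \<ge> 0"
  using up.Re_tr_star_mult_self_nonneg[OF joint_closed, of \<gamma> \<delta>] by (simp add: star_joint joint_idem joint_tr_def)

lemma joint_eq_0_of_disjoint: "e * e' = 0 \<Longrightarrow> joint \<gamma> \<delta> = 0"
proof -
  assume "e * e' = 0"
  have "joint \<gamma> \<delta> = (up.pr \<gamma> * e) * (e' * low.pr \<delta>)"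
    by (simp add: joint_def up.unit_right up.pr_closed low.unit_left low.pr_closed)
  also have "\<dots> = up.pr \<gamma> * (e * e') * low.pr \<delta>"
    by (simp only: mult.assoc)
  finally show ?thesis by (simp add: \<open>e * e' = 0\<close>)
qed

text \<open>The flowed block is evaluated twice, once with the lower and once with the upper weight.
  Each evaluation multiplies the same nonzero block by a character, so the two frequencies coincide.
  This is the step from imaginary to real powers.\<close>

lemma joint_low_joint:
  assumes x: "x \<in> C'" and nz: "joint \<gamma> \<gamma>' * x * joint \<delta> \<delta>' \<noteq> 0"
  shows "ln \<gamma>' - ln \<delta>' = ln \<gamma> - ln \<delta>"
proof (rule cis_family_inj)
  fix t
  have low: "joint \<gamma> \<gamma>' * (e * low.wflow t x) * joint \<delta> \<delta>' =
      exp (\<i> * complex_of_real t * complex_of_real (ln \<gamma>' - ln \<delta>')) *\<^sub>C (joint \<gamma> \<gamma>' * x * joint \<delta> \<delta>')"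
  proof -
    have "joint \<gamma> \<gamma>' * e = joint \<gamma> \<gamma>'" using up.unit_right joint_closed by blast
    then have "joint \<gamma> \<gamma>' * (e * low.wflow t x) * joint \<delta> \<delta>' =
        joint \<gamma> \<gamma>' * low.wflow t x * joint \<delta> \<delta>'"
      by (simp flip: mult.assoc)
    also have "\<dots> = up.pr \<gamma> * (low.pr \<gamma>' * low.wflow t x * low.pr \<delta>') * up.pr \<delta>"
      unfolding joint_def pr_commute[of \<delta> \<delta>'] by (simp only: mult.assoc)
    also have "\<dots> = exp (\<i> * complex_of_real t * complex_of_real (ln \<gamma>' - ln \<delta>')) *\<^sub>C
        (up.pr \<gamma> * (low.pr \<gamma>' * x * low.pr \<delta>') * up.pr \<delta>)"
      by (simp only: low.pr_wflow_pr scaleC_mult_left scaleC_mult_right)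
    also have "up.pr \<gamma> * (low.pr \<gamma>' * x * low.pr \<delta>') * up.pr \<delta> = joint \<gamma> \<gamma>' * x * joint \<delta> \<delta>'"
      unfolding joint_def pr_commute[of \<delta> \<delta>'] by (simp only: mult.assoc)
    finally show ?thesis .
  qed
  have up: "joint \<gamma> \<gamma>' * up.wflow t (e * x) * joint \<delta> \<delta>' =
      exp (\<i> * complex_of_real t * complex_of_real (ln \<gamma> - ln \<delta>)) *\<^sub>C (joint \<gamma> \<gamma>' * x * joint \<delta> \<delta>')"
  proof -
    have "joint \<gamma> \<gamma>' * up.wflow t (e * x) * joint \<delta> \<delta>' =
        low.pr \<gamma>' * (up.pr \<gamma> * up.wflow t (e * x) * up.pr \<delta>) * low.pr \<delta>'"
      unfolding joint_def pr_commute[of \<gamma> \<gamma>'] by (simp add: mult.assoc)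
    also have "\<dots> = exp (\<i> * complex_of_real t * complex_of_real (ln \<gamma> - ln \<delta>)) *\<^sub>C
        (low.pr \<gamma>' * (up.pr \<gamma> * (e * x) * up.pr \<delta>) * low.pr \<delta>')"
      by (simp only: up.pr_wflow_pr scaleC_mult_left scaleC_mult_right)
    also have "up.pr \<gamma> * (e * x) = up.pr \<gamma> * x"
      by (simp add: up.unit_right up.pr_closed flip: mult.assoc)
    also have "low.pr \<gamma>' * (up.pr \<gamma> * x * up.pr \<delta>) * low.pr \<delta>' = joint \<gamma> \<gamma>' * x * joint \<delta> \<delta>'"
      unfolding joint_def pr_commute[of \<gamma> \<gamma>'] by (simp add: mult.assoc)
    finally show ?thesis .
  qed
  show "exp (\<i> * complex_of_real t * complex_of_real (ln \<gamma>' - ln \<delta>')) =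
      exp (\<i> * complex_of_real t * complex_of_real (ln \<gamma> - ln \<delta>))"
    using low up[folded cut_wflow[OF x]] nz
      scaleC_right_cancel[of "exp (\<i> * complex_of_real t * complex_of_real (ln \<gamma>' - ln \<delta>'))"
        "joint \<gamma> \<gamma>' * x * joint \<delta> \<delta>'" "exp (\<i> * complex_of_real t * complex_of_real (ln \<gamma> - ln \<delta>))"]
    by argo
qed

text \<open>A quotient of the two densities. The exponents are chosen so that multiplying by
  \<open>low.wpow (- \<beta>)\<close> on the right cancels the lower factor and leaves the element
  whose trace is the numerator of \<open>kappa\<close>.\<close>

definition W :: "real \<Rightarrow> 'a" where
  "W \<beta> = up.wpow (complex_of_real (- \<beta>)) * low.wpow (complex_of_real \<beta>)"

lemma W_closed: "W \<beta> \<in> C"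
  unfolding W_def by (intro mult_low_closed up.wpow_closed low.wpow_closed)

lemma joint_W:
  "joint \<gamma> \<delta> * W \<beta> = exp (complex_of_real (\<beta> * (ln \<delta> - ln \<gamma>))) *\<^sub>C joint \<gamma> \<delta>"
proof -
  have "joint \<gamma> \<delta> * W \<beta> =
      low.pr \<delta> * (up.pr \<gamma> * up.wpow (complex_of_real (- \<beta>))) * low.wpow (complex_of_real \<beta>)"
    unfolding joint_def W_def pr_commute by (simp only: mult.assoc)
  also have "\<dots> = exp (complex_of_real (- \<beta>) * complex_of_real (ln \<gamma>)) *\<^sub>C
      (up.pr \<gamma> * (low.pr \<delta> * low.wpow (complex_of_real \<beta>)))"
    unfolding up.pr_wpow by (simp only: scaleC_mult_left scaleC_mult_right pr_commute[symmetric] mult.assoc)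
  also have "\<dots> = exp (complex_of_real (\<beta> * (ln \<delta> - ln \<gamma>))) *\<^sub>C joint \<gamma> \<delta>"
    unfolding low.pr_wpow
    by (simp add: scaleC_mult_right scaleC_scaleC joint_def right_diff_distrib flip: exp_add)
  finally show ?thesis .
qed

lemma W_joint:
  "W \<beta> * joint \<gamma> \<delta> = exp (complex_of_real (\<beta> * (ln \<delta> - ln \<gamma>))) *\<^sub>C joint \<gamma> \<delta>"
proof -
  have "W \<beta> * joint \<gamma> \<delta> =
      up.wpow (complex_of_real (- \<beta>)) * (low.wpow (complex_of_real \<beta>) * low.pr \<delta>) * up.pr \<gamma>"
    unfolding joint_def W_def pr_commute by (simp only: mult.assoc)
  also have "\<dots> = exp (complex_of_real \<beta> * complex_of_real (ln \<delta>)) *\<^sub>C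
      (up.wpow (complex_of_real (- \<beta>)) * up.pr \<gamma> * low.pr \<delta>)"
    unfolding low.wpow_pr by (simp only: scaleC_mult_left scaleC_mult_right pr_commute mult.assoc)
  also have "\<dots> = exp (complex_of_real (\<beta> * (ln \<delta> - ln \<gamma>))) *\<^sub>C joint \<gamma> \<delta>"
    unfolding up.wpow_pr
    by (simp add: scaleC_mult_left scaleC_scaleC joint_def right_diff_distrib flip: exp_add)
  finally show ?thesis .
qed

lemma pr_low_unit: "up.pr \<gamma> * e' = e' * up.pr \<gamma>"
  by (simp add: sum_distrib_left sum_distrib_right pr_commute flip: low.sum_pr)

lemma wpow_low_unit: "up.wpow s * e' = e' * up.wpow s"
  by (simp add: up.wpow_def sum_distrib_left sum_distrib_right scaleC_mult_left scaleC_mult_right pr_low_unit)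

lemma W_unit: "e * W \<beta> = W \<beta>" "W \<beta> * e = W \<beta>" "e' * W \<beta> = W \<beta>" "W \<beta> * e' = W \<beta>"
proof -
  show "e * W \<beta> = W \<beta>" "W \<beta> * e = W \<beta>"
    using W_closed up.unit_left up.unit_right by blast+
  have "e' * W \<beta> = up.wpow (complex_of_real (- \<beta>)) * (e' * low.wpow (complex_of_real \<beta>))"
    unfolding W_def by (simp only: wpow_low_unit[symmetric] mult.assoc[symmetric])
  then show "e' * W \<beta> = W \<beta>"
    by (simp add: W_def low.unit_left low.wpow_closed)
  show "W \<beta> * e' = W \<beta>"
    by (simp add: W_def mult.assoc low.unit_right low.wpow_closed)
qed

text \<open>The two flows agree on the lower corner, so on every nonzero block the modular factors
  on the left and on the right coincide.\<close>

lemma W_commute: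
  assumes x: "x \<in> C'"
  shows "W \<beta> * x = x * W \<beta>"
proof -
  define y where "y = W \<beta> * x - x * W \<beta>"
  have blocks: "joint \<gamma> \<gamma>' * y * joint \<delta> \<delta>' = 0" for \<gamma> \<gamma>' \<delta> \<delta>'
  proof (cases "joint \<gamma> \<gamma>' * x * joint \<delta> \<delta>' = 0")
    case False
    have "joint \<gamma> \<gamma>' * y * joint \<delta> \<delta>' =
        (joint \<gamma> \<gamma>' * W \<beta>) * x * joint \<delta> \<delta>' - joint \<gamma> \<gamma>' * x * (W \<beta> * joint \<delta> \<delta>')"
      by (simp add: y_def left_diff_distrib right_diff_distrib mult.assoc)
    also have "\<dots> = (exp (complex_of_real (\<beta> * (ln \<gamma>' - ln \<gamma>))) - exp (complex_of_real (\<beta> * (ln \<delta>' - ln \<delta>)))) *\<^sub>C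
        (joint \<gamma> \<gamma>' * x * joint \<delta> \<delta>')"
      by (simp only: joint_W W_joint scaleC_mult_left scaleC_mult_right scaleC_diff_left)
    also have "ln \<gamma>' - ln \<gamma> = ln \<delta>' - ln \<delta>"
      using joint_low_joint[OF x False] by linarith
    finally show ?thesis by simp
  next
    case True
    have "joint \<gamma> \<gamma>' * y * joint \<delta> \<delta>' =
        (joint \<gamma> \<gamma>' * W \<beta>) * x * joint \<delta> \<delta>' - joint \<gamma> \<gamma>' * x * (W \<beta> * joint \<delta> \<delta>')"
      by (simp add: y_def left_diff_distrib right_diff_distrib mult.assoc)
    then show ?thesis
      by (simp only: joint_W W_joint scaleC_mult_left scaleC_mult_right True) simp
  qed
  \<comment> \<open>The joint projections sum to \<open>e * e'\<close>, which fixes both terms of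
    \<open>y\<close> from the left and from the right. Hence \<open>y\<close> is the sum of its
    blocks, all of which vanish.\<close>
  define J where "J = (\<Sum>\<gamma>\<in>up.spec r. \<Sum>\<delta>\<in>low.spec r'. joint \<gamma> \<delta>)"
  have J: "J = e * e'"
    unfolding J_def joint_def
    by (simp only: up.sum_pr low.sum_pr sum_distrib_left[symmetric] sum_distrib_right[symmetric])
  have ex: "e * x = x * e" "e' * x = x" "x * e' = x"
    using x unit_comm low.unit_left low.unit_right by auto
  have "J * (W \<beta> * x) = e * (e' * W \<beta>) * x" by (simp only: J mult.assoc)
  then have JWx: "J * (W \<beta> * x) = W \<beta> * x" by (simp only: W_unit)
  have "J * (x * W \<beta>) = e * (e' * x) * W \<beta>" by (simp only: J mult.assoc)
  also have "\<dots> = x * (e * W \<beta>)" by (simp only: ex mult.assoc)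
  finally have JxW: "J * (x * W \<beta>) = x * W \<beta>" by (simp only: W_unit)
  have "W \<beta> * x * J = W \<beta> * (x * e) * e'" by (simp only: J mult.assoc)
  also have "\<dots> = (W \<beta> * e) * (x * e')" by (simp only: ex(1)[symmetric] mult.assoc)
  finally have WxJ: "W \<beta> * x * J = W \<beta> * x" by (simp only: W_unit ex)
  have "x * W \<beta> * J = x * (W \<beta> * e * e')" by (simp only: J mult.assoc)
  then have xWJ: "x * W \<beta> * J = x * W \<beta>" by (simp only: W_unit)
  have "y = J * y * J"
    by (simp only: y_def right_diff_distrib left_diff_distrib JWx JxW WxJ xWJ)
  also have "\<dots> = 0"
    unfolding J_def by (simp only: sum_distrib_left sum_distrib_right blocks sum.neutral_const)
  finally show ?thesis by (simp add: y_def)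
qed

lemma tr_W:
  "up.tr (W \<beta>) = complex_of_real (\<Sum>\<gamma>\<in>up.spec r. \<Sum>\<delta>\<in>low.spec r'. \<gamma> powr (- \<beta>) * \<delta> powr \<beta> * joint_tr \<gamma> \<delta>)"
proof -
  have W: "W \<beta> = (\<Sum>\<gamma>\<in>up.spec r. \<Sum>\<delta>\<in>low.spec r'.
      (exp (complex_of_real (- \<beta>) * complex_of_real (ln \<gamma>)) * exp (complex_of_real \<beta> * complex_of_real (ln \<delta>)))
        *\<^sub>C joint \<gamma> \<delta>)"
    unfolding W_def up.wpow_def low.wpow_def joint_def sum_product
    by (simp only: scaleC_mult_left scaleC_mult_right scaleC_scaleC mult.commute[of "exp _" "exp _"])
  show ?thesis
    unfolding W of_real_sum
    by (subst up.tr_sum, simp add: up.closed joint_closed, rule sum.cong[OF refl],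
        subst up.tr_sum, simp add: up.closed joint_closed, rule sum.cong[OF refl])
      (simp only: up.tr_scaleC joint_closed tr_joint exp_of_real_mult_ln up.spec_pos low.spec_pos of_real_mult)
qed

text \<open>\<open>x \<mapsto> tr (W \<beta> x)\<close> is a trace on the lower corner, hence a multiple of \<open>low.tr\<close>;
  the two sides are its values at the unit and at \<open>low.wpow (- \<beta>)\<close>.\<close>

lemma tr_W_eq:
  "up.tr (W \<beta>) * low.tr (low.wpow (complex_of_real (- \<beta>))) =
    of_nat d' * up.tr (up.wpow (complex_of_real (- \<beta>)) * e')"
proof -
  have Wx: "W \<beta> * x \<in> C" if "x \<in> C'" for x
    using that by (intro mult_low_closed W_closed)
  have "\<exists>c. \<forall>x\<in>C'. up.tr (W \<beta> * x) = c * low.tr x"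
  proof (rule low.tracial_functional_unique)
    fix x y assume x: "x \<in> C'" and y: "y \<in> C'"
    show "up.tr (W \<beta> * (x + y)) = up.tr (W \<beta> * x) + up.tr (W \<beta> * y)"
      using x y by (simp add: distrib_left up.tr_add Wx)
    \<comment> \<open>The upper trace is cyclic only on the upper corner, so \<open>x\<close> has to
      enter as its cut \<open>e * x\<close> before the factors are exchanged.\<close>
    have "W \<beta> * (x * y) = (e * x) * (W \<beta> * y)"
    proof -
      have "(e * x) * (W \<beta> * y) = x * (e * W \<beta>) * y" by (simp only: unit_comm[OF x] mult.assoc)
      also have "\<dots> = (x * W \<beta>) * y" by (simp only: W_unit)
      finally show ?thesis by (simp only: W_commute[OF x, symmetric] mult.assoc)
    qed
    then have "up.tr (W \<beta> * (x * y)) = up.tr ((W \<beta> * y) * (e * x))"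
      using up.tr_mult_comm[OF cut_closed[OF x] Wx[OF y]] by simp
    also have "(W \<beta> * y) * (e * x) = W \<beta> * (y * x)"
    proof -
      have "(W \<beta> * y) * (e * x) = W \<beta> * (y * e) * x" by (simp only: mult.assoc)
      also have "\<dots> = (W \<beta> * e) * (y * x)" by (simp only: unit_comm[OF y, symmetric] mult.assoc)
      finally show ?thesis by (simp only: W_unit)
    qed
    finally show "up.tr (W \<beta> * (x * y)) = up.tr (W \<beta> * (y * x))" .
  next
    fix x c assume x: "x \<in> C'"
    show "up.tr (W \<beta> * (c *\<^sub>C x)) = c * up.tr (W \<beta> * x)"
      using x by (simp add: scaleC_mult_right up.tr_scaleC Wx)
  qed
  then obtain c where c: "\<And>x. x \<in> C' \<Longrightarrow> up.tr (W \<beta> * x) = c * low.tr x" by blast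
  have "up.tr (W \<beta>) = c * of_nat d'"
    using c[OF low.unit_closed] by (simp add: W_unit low.tr_unit)
  moreover have "W \<beta> * low.wpow (complex_of_real (- \<beta>)) = up.wpow (complex_of_real (- \<beta>)) * e'"
    unfolding W_def by (simp add: mult.assoc low.wpow_add low.wpow_0)
  then have "up.tr (up.wpow (complex_of_real (- \<beta>)) * e') = c * low.tr (low.wpow (complex_of_real (- \<beta>)))"
    using c[OF low.wpow_closed, of "complex_of_real (- \<beta>)"] by simp
  ultimately show ?thesis by simp
qed

lemma double_sum_joint_tr:
  "(\<Sum>\<gamma>\<in>up.spec r. \<Sum>\<delta>\<in>low.spec r'. \<gamma> powr (- \<beta>) * \<delta> powr \<beta> * joint_tr \<gamma> \<delta>) *
      Re (low.tr (low.wpow (complex_of_real (- \<beta>)))) =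
    real d' * Re (up.tr (up.wpow (complex_of_real (- \<beta>)) * e'))"
proof -
  have "Re (up.tr (W \<beta>) * low.tr (low.wpow (complex_of_real (- \<beta>)))) =
      Re (of_nat d' * up.tr (up.wpow (complex_of_real (- \<beta>)) * e'))"
    by (simp only: tr_W_eq)
  moreover have "Re (of_nat n * w) = real n * Re w" for n and w :: complex by simp
  moreover have "Re (complex_of_real a * complex_of_real b) = a * b" for a b by simp
  ultimately show ?thesis
    unfolding tr_W low.tr_wpow_real Re_complex_of_real by (simp only:)
qed

section \<open>Positivity of the multiplicity\<close>

definition intertwiner_family :: "nat \<Rightarrow> (nat \<Rightarrow> complex mat) \<Rightarrow> bool" where
  "intertwiner_family k V \<longleftrightarrow>
     (\<forall>i<k. V i \<in> carrier_mat d d' \<and> (\<forall>x\<in>C'. \<phi> (e * x) * V i = V i * \<phi>' x)) \<and>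
     (\<forall>i<k. \<forall>j<k. mat_adjoint (V i) * V j = (if i = j then 1\<^sub>m d' else 0\<^sub>m d' d'))"

text \<open>The first columns of \<open>k\<close> orthogonal isometries are orthonormal. If \<open>k > d\<close>, padding them by
  zeros to a square matrix gives a left-invertible matrix with a zero row.\<close>

lemma intertwiner_family_bound:
  assumes "intertwiner_family k V"
  shows "k \<le> d"
proof (rule ccontr)
  assume "\<not> k \<le> d"
  define M where "M = mat k k (\<lambda>(a, i). if a < d then V i $$ (a, 0) else 0)"
  have M: "M \<in> carrier_mat k k" by (simp add: M_def)
  have V: "V i \<in> carrier_mat d d'" if "i < k" for i
    using assms that by (auto simp: intertwiner_family_def)
  have "mat_adjoint M * M = 1\<^sub>m k"
  proof (rule eq_matI)
    fix i j assume "i < dim_row (1\<^sub>m k :: complex mat)" "j < dim_col (1\<^sub>m k :: complex mat)"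
    then have ij: "i < k" "j < k" by auto
    have "(mat_adjoint M * M) $$ (i, j) = (\<Sum>a = 0..<k. cnj (M $$ (a, i)) * M $$ (a, j))"
      using ij M by (simp add: scalar_prod_def)
    also have "\<dots> = (\<Sum>a = 0..<d. cnj (M $$ (a, i)) * M $$ (a, j))"
      using ij \<open>\<not> k \<le> d\<close> by (intro sum.mono_neutral_right) (auto simp: M_def)
    also have "\<dots> = (\<Sum>a = 0..<d. cnj (V i $$ (a, 0)) * V j $$ (a, 0))"
      using ij \<open>\<not> k \<le> d\<close> by (intro sum.cong) (auto simp: M_def)
    also have "\<dots> = (mat_adjoint (V i) * V j) $$ (0, 0)"
      using V[OF ij(1)] V[OF ij(2)] low.dim_pos by (simp add: scalar_prod_def)
    also have "\<dots> = 1\<^sub>m k $$ (i, j)"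
      using assms ij low.dim_pos by (auto simp: intertwiner_family_def)
    finally show "(mat_adjoint M * M) $$ (i, j) = 1\<^sub>m k $$ (i, j)" .
  qed (use M in auto)
  then have "M * mat_adjoint M = 1\<^sub>m k"
    using mat_mult_left_right_inverse[of "mat_adjoint M" k M] M by simp
  then have "(M * mat_adjoint M) $$ (d, d) = 1" using \<open>\<not> k \<le> d\<close> by simp
  moreover have "(M * mat_adjoint M) $$ (d, d) = 0"
    using M \<open>\<not> k \<le> d\<close> by (auto simp: scalar_prod_def M_def intro!: sum.neutral)
  ultimately show False by simp
qed

text \<open>The isometry is built from a nonzero column of \<open>\<phi> (e u\<^sub>0\<^sub>0)\<close>, transported by the matrix
  units \<open>u\<^sub>i\<^sub>0\<close> of the lower corner.\<close>

lemma intertwiner_family_exists: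
  assumes "e * e' \<noteq> 0"
  shows "\<exists>V. intertwiner_family 1 V"
proof -
  define u where "u = (\<lambda>i j. e * low.munit i j)"
  have u: "u i j \<in> C" for i j by (simp add: u_def cut_closed low.munit_closed)
  have comm: "e * low.munit i j = low.munit i j * e" for i j
    by (simp add: unit_comm low.munit_closed)
  have star_u: "star (u i j) = u j i" for i j
    by (simp add: u_def star_mult low.star_munit up.star_unit comm)
  have u_mult: "u i j * u k l = (if j = k then u i l else 0)" if "j < d'" "k < d'" for i j k l
  proof -
    have "u i j * u k l = e * (low.munit i j * e) * low.munit k l"
      unfolding u_def by (simp only: mult.assoc)
    also have "\<dots> = e * e * (low.munit i j * low.munit k l)"
      by (simp only: comm[symmetric] mult.assoc)
    finally have "u i j * u k l = e * e * (low.munit i j * low.munit k l)" .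
    then show ?thesis
      using that by (simp add: low.munit_mult up.unit_left up.unit_closed u_def)
  qed
  \<comment> \<open>If \<open>u 0 0\<close> vanished, so would every \<open>u i i\<close>, and these
    sum to \<open>e * e'\<close>.\<close>
  have "u 0 0 \<noteq> 0"
  proof
    assume 0: "u 0 0 = 0"
    have "u i i = 0" if "i < d'" for i
    proof -
      have "u i i = u i 0 * (u 0 0 * u 0 i)"
        using that low.dim_pos by (simp add: u_mult)
      then show ?thesis by (simp add: 0)
    qed
    then have "(\<Sum>i<d'. u i i) = 0" by simp
    then show False using assms by (simp add: u_def low.sum_munit flip: sum_distrib_left)
  qed
  then have "\<phi> (u 0 0) \<noteq> 0\<^sub>m d d" using up.\<phi>_inj u up.zero_closed up.\<phi>_zero by metis
  then obtain a0 b where b: "a0 < d" "b < d" "\<phi> (u 0 0) $$ (a0, b) \<noteq> 0"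
    using u by (metis eq_matI up.\<phi>_dim index_zero_mat)
  define N where "N = (\<Sum>a<d. (cmod (\<phi> (u 0 0) $$ (a, b)))\<^sup>2)"
  have "N > 0" unfolding N_def using b by (intro sum_pos2[of _ a0]) auto
  \<comment> \<open>The inner product of the columns \<open>b\<close> of \<open>u i 0\<close> and
    \<open>u j 0\<close> is a diagonal entry of \<open>u 0 i * u j 0\<close>. It is therefore zero
    for distinct indices and the common value \<open>N\<close> otherwise, and \<open>s\<close>
    rescales these columns to an orthonormal family.\<close>
  have inner: "(\<Sum>a<d. cnj (\<phi> (u i 0) $$ (a, b)) * \<phi> (u j 0) $$ (a, b)) = \<phi> (u 0 i * u j 0) $$ (b, b)" for i j
    unfolding star_u[of i 0, symmetric] up.\<phi>_mult[OF up.star_closed[OF u] u] up.\<phi>_star[OF u]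
    using u b by (simp add: scalar_prod_def lessThan_atLeast0)
  have "complex_of_real N = (\<Sum>a<d. cnj (\<phi> (u 0 0) $$ (a, b)) * \<phi> (u 0 0) $$ (a, b))"
    by (simp add: N_def complex_norm_square mult.commute del: of_real_power)
  also have "\<dots> = \<phi> (u 0 0) $$ (b, b)"
    unfolding inner using u_mult[of 0 0 0 0] low.dim_pos by simp
  finally have N: "\<phi> (u 0 0) $$ (b, b) = complex_of_real N" ..
  define s where "s = complex_of_real (1 / sqrt N)"
  have s: "cnj s * s * complex_of_real N = 1"
    using \<open>N > 0\<close> by (simp add: s_def flip: of_real_mult)
  define V where "V = mat d d' (\<lambda>(a, i). s * \<phi> (u i 0) $$ (a, b))"
  have V: "V \<in> carrier_mat d d'" by (simp add: V_def)
  have "mat_adjoint V * V = 1\<^sub>m d'"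
  proof (rule eq_matI)
    fix i j assume "i < dim_row (1\<^sub>m d' :: complex mat)" "j < dim_col (1\<^sub>m d' :: complex mat)"
    then have ij: "i < d'" "j < d'" by auto
    have "(mat_adjoint V * V) $$ (i, j) =
        (\<Sum>a<d. cnj s * s * (cnj (\<phi> (u i 0) $$ (a, b)) * \<phi> (u j 0) $$ (a, b)))"
      using ij V by (auto simp: scalar_prod_def V_def lessThan_atLeast0 intro!: sum.cong)
    also have "\<dots> = cnj s * s * \<phi> (u 0 i * u j 0) $$ (b, b)"
      by (simp only: inner flip: sum_distrib_left)
    also have "\<dots> = 1\<^sub>m d' $$ (i, j)"
      using ij b s by (auto simp: u_mult N up.\<phi>_zero)
    finally show "(mat_adjoint V * V) $$ (i, j) = 1\<^sub>m d' $$ (i, j)" .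
  qed (use V in auto)
  moreover have "\<phi> (e * x) * V = V * \<phi>' x" if x: "x \<in> C'" for x
  proof (rule eq_matI)
    fix a i assume "a < dim_row (V * \<phi>' x)" "i < dim_col (V * \<phi>' x)"
    then have ai: "a < d" "i < d'" using V x by auto
    \<comment> \<open>Left multiplication by \<open>x\<close> acts on the first-column matrix units
      by the entries of \<open>\<phi>' x\<close>; after cutting by \<open>e\<close>, this is the
      intertwining relation for \<open>V\<close>.\<close>
    have "x * low.munit i 0 = (\<Sum>j<d'. low.munit j j) * x * low.munit i 0"
      using x by (simp add: low.sum_munit low.unit_left)
    also have "\<dots> = (\<Sum>j<d'. \<phi>' x $$ (j, i) *\<^sub>C low.munit j 0)"
      unfolding sum_distrib_right by (rule sum.cong) (auto simp: low.munit_sandwich x ai)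
    finally have xu: "x * low.munit i 0 = (\<Sum>j<d'. \<phi>' x $$ (j, i) *\<^sub>C low.munit j 0)" .
    have "(e * x) * u i 0 = e * (x * e) * low.munit i 0"
      unfolding u_def by (simp only: mult.assoc)
    also have "\<dots> = e * e * (x * low.munit i 0)"
      by (simp only: unit_comm[OF x, symmetric] mult.assoc)
    also have "\<dots> = (\<Sum>j<d'. \<phi>' x $$ (j, i) *\<^sub>C u j 0)"
      unfolding xu u_def by (simp add: up.unit_left up.unit_closed sum_distrib_left scaleC_mult_right)
    finally have exu: "(e * x) * u i 0 = (\<Sum>j<d'. \<phi>' x $$ (j, i) *\<^sub>C u j 0)" .
    have "(\<phi> (e * x) * V) $$ (a, i) = s * (\<phi> (e * x) * \<phi> (u i 0)) $$ (a, b)"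
      using ai x b u cut_closed[OF x]
      by (simp add: V_def scalar_prod_def sum_distrib_left mult_ac)
    also have "\<phi> (e * x) * \<phi> (u i 0) = \<phi> (\<Sum>j<d'. \<phi>' x $$ (j, i) *\<^sub>C u j 0)"
      by (simp only: up.\<phi>_mult[OF cut_closed[OF x] u, symmetric] exu)
    also have "s * \<dots> $$ (a, b) = (\<Sum>j<d'. s * \<phi> (u j 0) $$ (a, b) * \<phi>' x $$ (j, i))"
      using ai b u by (simp add: up.\<phi>_sum_index up.closed up.\<phi>_scaleC sum_distrib_left mult_ac)
    also have "\<dots> = (V * \<phi>' x) $$ (a, i)"
      using ai x V by (simp add: V_def scalar_prod_def lessThan_atLeast0)
    finally show "(\<phi> (e * x) * V) $$ (a, i) = (V * \<phi>' x) $$ (a, i)" .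
  qed (use V that in \<open>auto simp: cut_closed\<close>)
  ultimately show ?thesis
    using V by (intro exI[of _ "\<lambda>_. V"]) (auto simp: intertwiner_family_def)
qed

text \<open>The bound by \<open>d\<close> makes the set finite, so that \<open>Max\<close> is its
  true maximum, and one isometric intertwiner shows that it is at least 1.\<close>

lemma Max_intertwiner_family_pos:
  assumes "e * e' \<noteq> 0"
  shows "Max {k. \<exists>V. intertwiner_family k V} > 0"
proof -
  have "finite {k. \<exists>V. intertwiner_family k V}"
    by (rule finite_subset[of _ "{..d}"]) (auto dest: intertwiner_family_bound)
  then have "1 \<le> Max {k. \<exists>V. intertwiner_family k V}"
    using intertwiner_family_exists[OF assms] by (intro Max_ge) auto
  then show ?thesis by simp
qed

end

section \<open>Harmonic functions on the tower\<close>

context flow_on_tower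
begin

section \<open>The corners of the tower\<close>

lemma
  shows one_mem_A: "1 \<in> A n"
    and add_mem_A: "\<lbrakk>x \<in> A n; y \<in> A n\<rbrakk> \<Longrightarrow> x + y \<in> A n"
    and mult_mem_A: "\<lbrakk>x \<in> A n; y \<in> A n\<rbrakk> \<Longrightarrow> x * y \<in> A n"
    and star_mem_A: "x \<in> A n \<Longrightarrow> star x \<in> A n"
    and scaleC_mem_A: "x \<in> A n \<Longrightarrow> c *\<^sub>C x \<in> A n"
  using A_subalgebra[of n] unfolding cstar_subalgebra_def by blast+

lemma
  assumes "z \<in> Z n"
  shows Z_mem_A: "z \<in> A n"
    and Z_star: "star z = z"
    and Z_idem: "z * z = z"
    and Z_nonzero: "z \<noteq> 0"
    and Z_central: "x \<in> A n \<Longrightarrow> z * x = x * z"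
  using assms unfolding Z_def minimal_projections_def projections_def alg_center_def by auto

lemma corner_iff:
  assumes "z \<in> Z n"
  shows "x \<in> corner n z \<longleftrightarrow> x \<in> A n \<and> z * x = x"
proof
  assume "x \<in> corner n z"
  then obtain y where "y \<in> A n" "x = z * y" by (auto simp: corner_def)
  then show "x \<in> A n \<and> z * x = x"
    using assms by (simp add: mult_mem_A Z_mem_A Z_idem flip: mult.assoc)
next
  assume "x \<in> A n \<and> z * x = x"
  then show "x \<in> corner n z" unfolding corner_def by (metis image_eqI)
qed

lemma weighted_corner_Z:
  assumes z: "z \<in> Z n"
  shows "weighted_corner (corner n z) z (\<pi> n z) (d n z) (\<rho> n z)"
proof
  note iff = corner_iff[OF z]
  show "x + y \<in> corner n z" if "x \<in> corner n z" "y \<in> corner n z" for x y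
    using that by (simp add: iff add_mem_A distrib_left)
  show "x * y \<in> corner n z" if "x \<in> corner n z" "y \<in> corner n z" for x y
    using that by (simp add: iff mult_mem_A flip: mult.assoc)
  show "c *\<^sub>C x \<in> corner n z" if "x \<in> corner n z" for x c
    using that by (simp add: iff scaleC_mem_A scaleC_mult_right)
  show "star x \<in> corner n z" if x: "x \<in> corner n z" for x
  proof -
    have "z * star x = star x * z" using x Z_central[OF z star_mem_A, of x] by (simp add: iff)
    also have "\<dots> = star (z * x)" using z by (simp add: star_mult Z_star)
    finally show ?thesis using x by (simp add: iff star_mem_A)
  qed
  show "z \<in> corner n z" using z by (simp add: iff Z_mem_A Z_idem)
  show "z * x = x" if "x \<in> corner n z" for x using that by (simp add: iff)
  show "x * z = x" if "x \<in> corner n z" for x using that Z_central[OF z, of x] by (simp add: iff)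
  show "z \<noteq> 0" using z by (rule Z_nonzero)
  show "\<exists>\<sigma>\<in>corner n z. \<sigma> * \<rho> n z = z" using \<rho>_invertible_normalized[OF z] by blast
qed (use z in \<open>auto intro: \<pi>_bij \<pi>_add \<pi>_mult \<pi>_scaleC \<pi>_star \<rho>_positive\<close>)

lemma d_pos: "z \<in> Z n \<Longrightarrow> d n z > 0"
  using matrix_corner.dim_pos weighted_corner.axioms(1) weighted_corner_Z by blast

lemma
  assumes z: "z \<in> Z n"
  shows eigvals_eq: "eigvals n z = matrix_corner.spec (\<pi> n z) (\<rho> n z)"
    and p_eq: "p n z \<gamma> = matrix_corner.eigproj (corner n z) (\<pi> n z) (\<rho> n z) \<gamma>"
    and Tr_eq: "Tr n z x = matrix_corner.tr (\<pi> n z) x"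
    and rho_power_eq: "rho_power n z s = weighted_corner.wpow (corner n z) (\<pi> n z) (\<rho> n z) s"
proof -
  interpret c: weighted_corner "corner n z" z "\<pi> n z" "d n z" "\<rho> n z"
    using z by (rule weighted_corner_Z)
  show eig: "eigvals n z = c.spec (\<rho> n z)"
    by (simp add: eigvals_def c.spec_def)
  show p: "p n z \<gamma> = c.pr \<gamma>" for \<gamma>
    by (simp add: p_def c.eigproj_def)
  show "Tr n z x = c.tr x"
    by (simp add: Tr_def c.tr_def)
  show "rho_power n z s = c.wpow s"
    by (simp add: rho_power_def c.wpow_def eig p)
qed

lemma \<alpha>_eq_wflow:
  assumes z: "z \<in> Z n" and x: "x \<in> corner n z"
  shows "\<alpha> t x = weighted_corner.wflow (corner n z) (\<pi> n z) (\<rho> n z) t x"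
proof -
  interpret c: weighted_corner "corner n z" z "\<pi> n z" "d n z" "\<rho> n z"
    using z by (rule weighted_corner_Z)
  show ?thesis
    by (simp add: \<rho>_implements[OF z x] c.wflow_def rho_power_eq[OF z])
qed

text \<open>Both corner flows are restrictions of \<alpha>. Since \<alpha> is multiplicative and
  fixes \<open>z\<close>, the unit of the corner on which it acts by conjugation with a unitary,
  cutting by \<open>z\<close> commutes with the flow.\<close>

lemma weighted_inclusion_Z:
  assumes z: "z \<in> Z (Suc n)" and z': "z' \<in> Z n"
  shows "weighted_inclusion (corner (Suc n) z) z (\<pi> (Suc n) z) (d (Suc n) z) (\<rho> (Suc n) z)
    (corner n z') z' (\<pi> n z') (d n z') (\<rho> n z')"
proof -
  interpret up: weighted_corner "corner (Suc n) z" z "\<pi> (Suc n) z" "d (Suc n) z" "\<rho> (Suc n) z"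
    using z by (rule weighted_corner_Z)
  interpret low: weighted_corner "corner n z'" z' "\<pi> n z'" "d n z'" "\<rho> n z'"
    using z' by (rule weighted_corner_Z)
  have mem: "x \<in> A (Suc n)" if "x \<in> corner n z'" for x
    using that z' A_inclusion by (auto simp: corner_iff)
  have cut: "z * x \<in> corner (Suc n) z" if "x \<in> corner n z'" for x
    using mem[OF that] by (auto simp: corner_def)
  show ?thesis
  proof
    fix x assume x: "x \<in> corner n z'"
    show "z * x = x * z" using Z_central[OF z mem[OF x]] .
    show "z * x \<in> corner (Suc n) z" using cut x .
    have "\<alpha> t (z * x) = \<alpha> t z * \<alpha> t x" for t
      using \<alpha>_automorphism[of t] unfolding star_automorphism_def by blast
    moreover have "\<alpha> t z = z" for t
      using \<alpha>_eq_wflow[OF z up.unit_closed] up.wflow_unit by simp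
    ultimately show "z * low.wflow t x = up.wflow t (z * x)" for t
      using \<alpha>_eq_wflow[OF z cut[OF x]] \<alpha>_eq_wflow[OF z' x] by simp
  qed
qed

lemma
  assumes "z \<in> Z n"
  shows finite_eigvals: "finite (eigvals n z)"
    and eigvals_pos: "\<gamma> \<in> eigvals n z \<Longrightarrow> \<gamma> > 0"
    and dim_beta_pos: "dim_beta \<beta> n z > 0"
proof -
  interpret c: weighted_corner "corner n z" z "\<pi> n z" "d n z" "\<rho> n z"
    using assms by (rule weighted_corner_Z)
  show "finite (eigvals n z)" "\<gamma> \<in> eigvals n z \<Longrightarrow> \<gamma> > 0" "dim_beta \<beta> n z > 0"
    using c.finite_spec_weight c.spec_pos c.Re_tr_wpow_real_pos[of "- \<beta>"]
    by (simp_all add: dim_beta_def eigvals_eq assms Tr_eq rho_power_eq)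
qed

section \<open>The weight group and the transition weights\<close>

lemma
  shows \<Gamma>_one: "1 \<in> \<Gamma>"
    and \<Gamma>_mult: "\<lbrakk>\<gamma> \<in> \<Gamma>; \<delta> \<in> \<Gamma>\<rbrakk> \<Longrightarrow> \<gamma> * \<delta> \<in> \<Gamma>"
    and \<Gamma>_inverse: "\<gamma> \<in> \<Gamma> \<Longrightarrow> inverse \<gamma> \<in> \<Gamma>"
    and \<Gamma>_pos: "\<gamma> \<in> \<Gamma> \<Longrightarrow> \<gamma> > 0"
    and eigvals_subset_\<Gamma>: "z \<in> Z n \<Longrightarrow> eigvals n z \<subseteq> \<Gamma>"
proof -
  have ex_inv: "\<exists>y>0. y * x = 1" if "x > 0" for x :: real
    using that by (intro exI[of _ "inverse x"]) auto
  interpret G: group pos_reals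
    by (rule groupI) (use ex_inv in \<open>auto simp: pos_reals_def\<close>)
  define H where "H = (\<Union>(n, z)\<in>ZZ. eigvals n z)"
  have H: "H \<subseteq> carrier pos_reals"
    by (auto simp: H_def ZZ_def pos_reals_def eigvals_pos)
  interpret S: subgroup \<Gamma> pos_reals
    unfolding \<Gamma>_def H_def[symmetric] by (rule G.generate_is_subgroup[OF H])
  show "1 \<in> \<Gamma>" using S.one_closed by (simp add: pos_reals_def)
  show "\<gamma> * \<delta> \<in> \<Gamma>" if "\<gamma> \<in> \<Gamma>" "\<delta> \<in> \<Gamma>"
    using S.m_closed[OF that] by (simp add: pos_reals_def)
  show pos: "\<gamma> > 0" if "\<gamma> \<in> \<Gamma>" for \<gamma>
    using S.subset that by (auto simp: pos_reals_def)
  show "inverse \<gamma> \<in> \<Gamma>" if "\<gamma> \<in> \<Gamma>"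
  proof -
    have "inv\<^bsub>pos_reals\<^esub> \<gamma> = inverse \<gamma>"
      using pos[OF that] by (intro G.inv_equality) (auto simp: pos_reals_def)
    then show ?thesis using S.m_inv_closed[OF that] by simp
  qed
  show "eigvals n z \<subseteq> \<Gamma>" if "z \<in> Z n"
    using that generate.incl[of _ H pos_reals] by (auto simp: \<Gamma>_def H_def[symmetric]) (auto simp: H_def ZZ_def)
qed

definition joint_trace :: "nat \<Rightarrow> 'a \<Rightarrow> 'a \<Rightarrow> real \<Rightarrow> real \<Rightarrow> real" where
  "joint_trace n z z' \<gamma> \<delta> = Re (Tr (Suc n) z (p (Suc n) z \<gamma> * p n z' \<delta>))"

text \<open>In \<open>mu_eq\<close> the case split on the multiplicity has disappeared and the sum
  over \<Gamma> in \<open>q\<close> has become finite, since the lower eigenprojection is zero off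
  the spectrum. The last claim is the trace identity for \<open>W\<close> in the notation of the
  tower.\<close>

lemma
  assumes z: "z \<in> Z (Suc n)" and z': "z' \<in> Z n"
  shows joint_trace_nonneg: "joint_trace n z z' \<gamma> \<delta> \<ge> 0"
    and joint_trace_eq_0: "\<gamma> \<notin> eigvals (Suc n) z \<Longrightarrow> joint_trace n z z' \<gamma> \<delta> = 0"
    and mu_eq: "mu n (z, \<gamma>) (z', \<gamma>') =
      (\<Sum>\<delta>\<in>eigvals n z'. joint_trace n z z' (inverse \<gamma> * \<gamma>' * \<delta>) \<delta>) / real (d (Suc n) z)"
    and sum_joint_trace: "(\<Sum>\<gamma>\<in>eigvals (Suc n) z. \<Sum>\<delta>\<in>eigvals n z'.
        \<gamma> powr (- \<beta>) * \<delta> powr \<beta> * joint_trace n z z' \<gamma> \<delta>) * dim_beta \<beta> n z' =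
      real (d n z') * (kappa \<beta> n z z' * dim_beta \<beta> (Suc n) z)"
proof -
  interpret weighted_inclusion "corner (Suc n) z" z "\<pi> (Suc n) z" "d (Suc n) z" "\<rho> (Suc n) z"
    "corner n z'" z' "\<pi> n z'" "d n z'" "\<rho> n z'"
    using assms by (rule weighted_inclusion_Z)
  note up_eq = eigvals_eq[OF z] p_eq[OF z] Tr_eq[OF z] rho_power_eq[OF z]
  note low_eq = eigvals_eq[OF z'] p_eq[OF z'] Tr_eq[OF z'] rho_power_eq[OF z']
  have joint_tr: "joint_trace n z z' = joint_tr"
    by (simp add: fun_eq_iff joint_trace_def joint_tr_def joint_def up_eq low_eq)
  show "joint_trace n z z' \<gamma> \<delta> \<ge> 0" by (simp add: joint_tr joint_tr_nonneg)
  show "joint_trace n z z' \<gamma> \<delta> = 0" if "\<gamma> \<notin> eigvals (Suc n) z"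
    using that up.pr_eq_0_iff[of \<gamma>] by (simp add: joint_tr joint_tr_def joint_def up_eq up.tr_zero)
  have low_pr_eq_0: "low.pr \<delta> = 0" if "\<delta> \<notin> eigvals n z'" for \<delta>
    using that low.pr_eq_0_iff by (simp add: low_eq(1))
  have q: "q n z z' \<gamma> = (\<Sum>\<delta>\<in>eigvals n z'. joint (\<gamma> * \<delta>) \<delta>)" for \<gamma>
  proof -
    have "q n z z' \<gamma> = (\<Sum>\<^sub>\<infinity>\<delta>\<in>eigvals n z'. joint (\<gamma> * \<delta>) \<delta>)"
      unfolding q_def joint_def up_eq(2) low_eq(2)
      by (rule infsum_cong_neutral) (use eigvals_subset_\<Gamma>[OF z'] low_pr_eq_0 in auto)
    then show ?thesis using finite_eigvals[OF z'] by simp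
  qed
  have Tr_q: "Re (Tr (Suc n) z (q n z z' \<gamma>)) = (\<Sum>\<delta>\<in>eigvals n z'. joint_tr (\<gamma> * \<delta>) \<delta>)" for \<gamma>
    unfolding q up_eq(3) joint_tr_def by (subst up.tr_sum) (auto simp: joint_closed)
  have mult: "multiplicity n z z' = Max {k. \<exists>V. intertwiner_family k V}"
    by (simp add: multiplicity_def intertwiner_family_def)
  show "mu n (z, \<gamma>) (z', \<gamma>') =
      (\<Sum>\<delta>\<in>eigvals n z'. joint_trace n z z' (inverse \<gamma> * \<gamma>' * \<delta>) \<delta>) / real (d (Suc n) z)"
  \<comment> \<open>For disjoint \<open>z\<close> and \<open>z'\<close> all joint traces vanish, so
    both branches of \<open>mu\<close> are zero; otherwise the multiplicity is positive and the
    first branch applies.\<close>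
  proof (cases "z * z' = 0")
    case True
    then have "joint_tr \<gamma> \<delta> = 0" for \<gamma> \<delta>
      by (simp add: joint_tr_def joint_eq_0_of_disjoint up.tr_zero)
    then show ?thesis by (simp add: mu_def joint_tr Tr_q)
  next
    case False
    then show ?thesis using Max_intertwiner_family_pos by (simp add: mu_def joint_tr Tr_q mult)
  qed
  have "kappa \<beta> n z z' * dim_beta \<beta> (Suc n) z =
      Re (up.tr (up.wpow (complex_of_real (- \<beta>)) * z'))"
    using dim_beta_pos[OF z, of \<beta>] by (simp add: kappa_def up_eq)
  then show "(\<Sum>\<gamma>\<in>eigvals (Suc n) z. \<Sum>\<delta>\<in>eigvals n z'.
        \<gamma> powr (- \<beta>) * \<delta> powr \<beta> * joint_trace n z z' \<gamma> \<delta>) * dim_beta \<beta> n z' =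
      real (d n z') * (kappa \<beta> n z z' * dim_beta \<beta> (Suc n) z)"
    using double_sum_joint_tr[of \<beta>] by (simp add: joint_tr up_eq low_eq dim_beta_def)
qed

lemma mu_nonneg: "\<lbrakk>z \<in> Z (Suc n); z' \<in> Z n\<rbrakk> \<Longrightarrow> mu n (z, \<gamma>) (z', \<gamma>') \<ge> 0"
  by (auto simp: mu_eq intro!: divide_nonneg_nonneg sum_nonneg joint_trace_nonneg)

definition ratio :: "real \<Rightarrow> nat \<Rightarrow> 'a \<Rightarrow> real" where
  "ratio \<beta> n z = real (d n z) / dim_beta \<beta> n z"

lemma ratio_pos: "z \<in> Z n \<Longrightarrow> ratio \<beta> n z > 0"
  by (simp add: ratio_def d_pos dim_beta_pos)

text \<open>Summing out the weight variable turns a row of \<open>mu\<close> into an entry of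
  \<open>kappa\<close>, conjugated by the diagonal \<open>ratio\<close>. The \<gamma>-sum is the
  trace of \<open>W\<close> up to explicit factors.\<close>

lemma mu_powr_has_sum:
  assumes z: "z \<in> Z (Suc n)" and z': "z' \<in> Z n" and \<gamma>': "\<gamma>' \<in> \<Gamma>"
  shows "((\<lambda>\<gamma>. \<gamma> powr \<beta> * mu n (z, \<gamma>) (z', \<gamma>')) has_sum
    \<gamma>' powr \<beta> * kappa \<beta> n z z' * ratio \<beta> n z' / ratio \<beta> (Suc n) z) \<Gamma>"
proof -
  define t where "t = joint_trace n z z'"
  define E where "E = eigvals (Suc n) z"
  define E' where "E' = eigvals n z'"
  have sub: "E \<subseteq> \<Gamma>" "E' \<subseteq> \<Gamma>" "finite E" "finite E'"
    using z z' by (auto simp: E_def E'_def finite_eigvals dest: eigvals_subset_\<Gamma>[THEN subsetD])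
  have column: "((\<lambda>\<gamma>. \<gamma> powr \<beta> * t (inverse \<gamma> * \<gamma>' * \<delta>) \<delta>) has_sum
      (\<Sum>\<epsilon>\<in>E. (\<gamma>' * \<delta> * inverse \<epsilon>) powr \<beta> * t \<epsilon> \<delta>)) \<Gamma>" if \<delta>: "\<delta> \<in> \<Gamma>" for \<delta>
  proof -
    have "\<gamma>' * \<delta> * inverse (\<gamma>' * \<delta> * inverse \<epsilon>) = \<epsilon>" for \<epsilon>
      using \<Gamma>_pos[OF \<gamma>'] \<Gamma>_pos[OF \<delta>] by (simp add: field_simps)
    moreover have "\<gamma>' * \<delta> * inverse \<epsilon> \<in> \<Gamma>" if "\<epsilon> \<in> \<Gamma>" for \<epsilon>
      using that \<gamma>' \<delta> by (intro \<Gamma>_mult \<Gamma>_inverse)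
    \<comment> \<open>The substitution is its own inverse on \<Gamma>. It makes the first argument
      of \<open>t\<close> equal to \<epsilon>, so only the finitely many upper eigenvalues
      contribute.\<close>
    ultimately have bij: "bij_betw (\<lambda>\<epsilon>. \<gamma>' * \<delta> * inverse \<epsilon>) \<Gamma> \<Gamma>"
      by (intro bij_betw_byWitness[where f' = "\<lambda>\<epsilon>. \<gamma>' * \<delta> * inverse \<epsilon>"]) blast+
    have cancel: "inverse (\<gamma>' * \<delta> * inverse \<epsilon>) * \<gamma>' * \<delta> = \<epsilon>" for \<epsilon>
      using \<Gamma>_pos[OF \<gamma>'] \<Gamma>_pos[OF \<delta>] by (simp add: field_simps)
    have "t \<epsilon> \<delta> = 0" if "\<epsilon> \<notin> E" for \<epsilon>
      using that z z' unfolding t_def E_def by (rule joint_trace_eq_0[rotated 2])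
    then have "((\<lambda>\<epsilon>. (\<gamma>' * \<delta> * inverse \<epsilon>) powr \<beta> * t (inverse (\<gamma>' * \<delta> * inverse \<epsilon>) * \<gamma>' * \<delta>) \<delta>) has_sum
        (\<Sum>\<epsilon>\<in>E. (\<gamma>' * \<delta> * inverse \<epsilon>) powr \<beta> * t \<epsilon> \<delta>)) \<Gamma>"
      unfolding cancel using sub by (intro has_sum_finite_neutralI[of E]) auto
    then show ?thesis by (subst has_sum_reindex_bij_betw[OF bij, symmetric])
  qed
  have mu: "\<gamma> powr \<beta> * mu n (z, \<gamma>) (z', \<gamma>') =
      inverse (real (d (Suc n) z)) * (\<Sum>\<delta>\<in>E'. \<gamma> powr \<beta> * t (inverse \<gamma> * \<gamma>' * \<delta>) \<delta>)" for \<gamma>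
    using z z' by (simp add: mu_eq t_def E'_def sum_distrib_left divide_inverse mult_ac)
  have "((\<lambda>\<gamma>. \<Sum>\<delta>\<in>E'. \<gamma> powr \<beta> * t (inverse \<gamma> * \<gamma>' * \<delta>) \<delta>) has_sum
      (\<Sum>\<delta>\<in>E'. \<Sum>\<epsilon>\<in>E. (\<gamma>' * \<delta> * inverse \<epsilon>) powr \<beta> * t \<epsilon> \<delta>)) \<Gamma>"
    using \<open>finite E'\<close> \<open>E' \<subseteq> \<Gamma>\<close>
    by (induction E' rule: finite_induct) (auto intro!: has_sum_add column)
  also have "(\<Sum>\<delta>\<in>E'. \<Sum>\<epsilon>\<in>E. (\<gamma>' * \<delta> * inverse \<epsilon>) powr \<beta> * t \<epsilon> \<delta>) =
      \<gamma>' powr \<beta> * (\<Sum>\<epsilon>\<in>E. \<Sum>\<delta>\<in>E'. \<epsilon> powr (- \<beta>) * \<delta> powr \<beta> * t \<epsilon> \<delta>)"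
  proof -
    have "(\<gamma>' * \<delta> * inverse \<epsilon>) powr \<beta> * t \<epsilon> \<delta> = \<gamma>' powr \<beta> * (\<epsilon> powr (- \<beta>) * \<delta> powr \<beta> * t \<epsilon> \<delta>)"
      if "\<epsilon> \<in> E" "\<delta> \<in> E'" for \<epsilon> \<delta>
    proof -
      have "\<epsilon> > 0" "\<delta> > 0" "\<gamma>' > 0" using that sub \<gamma>' \<Gamma>_pos by auto
      then show ?thesis
        by (simp add: powr_mult powr_minus inverse_powr mult_ac)
    qed
    then show ?thesis
      unfolding sum_distrib_left by (subst sum.swap) (intro sum.cong refl)
  qed
  also have "(\<Sum>\<epsilon>\<in>E. \<Sum>\<delta>\<in>E'. \<epsilon> powr (- \<beta>) * \<delta> powr \<beta> * t \<epsilon> \<delta>) =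
      real (d n z') * (kappa \<beta> n z z' * dim_beta \<beta> (Suc n) z) / dim_beta \<beta> n z'"
    using sum_joint_trace[OF z z', of \<beta>] dim_beta_pos[OF z', of \<beta>]
    by (simp add: t_def E_def E'_def field_simps)
  finally have "((\<lambda>\<gamma>. \<gamma> powr \<beta> * mu n (z, \<gamma>) (z', \<gamma>')) has_sum inverse (real (d (Suc n) z)) *
      (\<gamma>' powr \<beta> * (real (d n z') * (kappa \<beta> n z z' * dim_beta \<beta> (Suc n) z) / dim_beta \<beta> n z'))) \<Gamma>"
    unfolding mu by (rule has_sum_cmult_right)
  then show ?thesis
    by (simp add: ratio_def field_simps)
qed

text \<open>The right side does not mention \<gamma>', so for a scaling function the equations at
  all weights over \<open>z'\<close> are one condition. Going from the double to the iterated sum is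
  general; for the converse, nonnegative terms give summability on the product, and uniqueness of
  sums fixes the value.\<close>

lemma harmonic_iff:
  assumes z': "z' \<in> Z n" and \<gamma>': "\<gamma>' \<in> \<Gamma>" and nonneg: "\<And>z. z \<in> Z (Suc n) \<Longrightarrow> \<nu> z \<ge> 0"
  shows "((\<lambda>(z, \<gamma>). (ratio \<beta> (Suc n) z * \<nu> z * \<gamma> powr \<beta>) * mu n (z, \<gamma>) (z', \<gamma>')) has_sum
      ratio \<beta> n z' * s * \<gamma>' powr \<beta>) (Z (Suc n) \<times> \<Gamma>) \<longleftrightarrow>
    ((\<lambda>z. \<nu> z * kappa \<beta> n z z') has_sum s) (Z (Suc n))"
proof -
  define f where "f = (\<lambda>(z, \<gamma>). (ratio \<beta> (Suc n) z * \<nu> z * \<gamma> powr \<beta>) * mu n (z, \<gamma>) (z', \<gamma>'))"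
  define g where "g z = ratio \<beta> n z' * \<gamma>' powr \<beta> * (\<nu> z * kappa \<beta> n z z')" for z
  have nz: "ratio \<beta> n z' * \<gamma>' powr \<beta> \<noteq> 0"
    using ratio_pos[OF z', of \<beta>] \<Gamma>_pos[OF \<gamma>'] by simp
  have row: "((\<lambda>\<gamma>. f (z, \<gamma>)) has_sum g z) \<Gamma>" if z: "z \<in> Z (Suc n)" for z
  proof -
    have "((\<lambda>\<gamma>. ratio \<beta> (Suc n) z * \<nu> z * (\<gamma> powr \<beta> * mu n (z, \<gamma>) (z', \<gamma>'))) has_sum
        ratio \<beta> (Suc n) z * \<nu> z * (\<gamma>' powr \<beta> * kappa \<beta> n z z' * ratio \<beta> n z' / ratio \<beta> (Suc n) z)) \<Gamma>"
      by (intro has_sum_cmult_right mu_powr_has_sum z z' \<gamma>')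
    moreover have "ratio \<beta> (Suc n) z * \<nu> z * (\<gamma>' powr \<beta> * kappa \<beta> n z z' * ratio \<beta> n z' / ratio \<beta> (Suc n) z) = g z"
      using ratio_pos[OF z, of \<beta>] by (simp add: g_def)
    ultimately show ?thesis
      by (simp add: f_def mult.assoc)
  qed
  have f_nonneg: "f (z, \<gamma>) \<ge> 0" if "z \<in> Z (Suc n)" for z \<gamma>
    using nonneg[OF that] ratio_pos[OF that, of \<beta>] mu_nonneg[OF that z'] by (simp add: f_def)
  have "(f has_sum ratio \<beta> n z' * s * \<gamma>' powr \<beta>) (Z (Suc n) \<times> \<Gamma>) \<longleftrightarrow>
      (g has_sum ratio \<beta> n z' * s * \<gamma>' powr \<beta>) (Z (Suc n))"
  proof
    assume "(f has_sum ratio \<beta> n z' * s * \<gamma>' powr \<beta>) (Z (Suc n) \<times> \<Gamma>)"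
    then show "(g has_sum ratio \<beta> n z' * s * \<gamma>' powr \<beta>) (Z (Suc n))"
      using row by (rule has_sum_Sigma')
  next
    assume g: "(g has_sum ratio \<beta> n z' * s * \<gamma>' powr \<beta>) (Z (Suc n))"
    have "f summable_on Z (Suc n) \<times> \<Gamma>"
      using row has_sum_imp_summable[OF g] f_nonneg by (rule summable_on_SigmaI)
    then have f: "(f has_sum infsum f (Z (Suc n) \<times> \<Gamma>)) (Z (Suc n) \<times> \<Gamma>)"
      by (rule has_sum_infsum)
    then have "(g has_sum infsum f (Z (Suc n) \<times> \<Gamma>)) (Z (Suc n))"
      using row by (rule has_sum_Sigma')
    with g have "infsum f (Z (Suc n) \<times> \<Gamma>) = ratio \<beta> n z' * s * \<gamma>' powr \<beta>"
      using has_sum_unique by blast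
    with f show "(f has_sum ratio \<beta> n z' * s * \<gamma>' powr \<beta>) (Z (Suc n) \<times> \<Gamma>)" by simp
  qed
  also have "\<dots> \<longleftrightarrow> ((\<lambda>z. \<nu> z * kappa \<beta> n z z') has_sum s) (Z (Suc n))"
    unfolding g_def has_sum_cmult_right_iff[OF nz] using nz by simp
  finally show ?thesis by (simp only: f_def)
qed

lemma one_mem_Z_0: "1 \<in> Z 0"
proof -
  have "q = 0 \<or> q = 1" if "q \<in> projections (alg_center (A 0))" for q
  proof -
    have "q \<in> A 0" "q * q = q"
      using that by (auto simp: projections_def alg_center_def)
    then obtain c where c: "q = c *\<^sub>C 1"
      using A_0 by blast
    with \<open>q * q = q\<close> have "(c * c) *\<^sub>C (1 :: 'a) = c *\<^sub>C 1"
      by (simp add: scaleC_mult_left scaleC_scaleC)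
    then have "c * c = c"
      using scaleC_right_cancel[of "c * c" "1 :: 'a" c] by auto
    then show ?thesis using c by auto
  qed
  then show ?thesis
    by (auto simp: Z_def minimal_projections_def projections_def alg_center_def one_mem_A)
qed

text \<open>At the root the weight is scalar because \<open>A 0\<close> consists of scalars. Hence
  passing between \<kappa> and \<open>mu\<close> keeps the value 1 at the root.\<close>

lemma ratio_0: "ratio \<beta> 0 1 = 1"
proof -
  interpret c: weighted_corner "corner 0 1" 1 "\<pi> 0 1" "d 0 1" "\<rho> 0 1"
    using one_mem_Z_0 by (rule weighted_corner_Z)
  obtain k where k: "\<rho> 0 1 = k *\<^sub>C 1"
    using c.weight_closed A_0 by (auto simp: corner_iff[OF one_mem_Z_0])
  obtain \<sigma> where "\<sigma> \<in> corner 0 1" "\<sigma> * \<rho> 0 1 = 1" "c.tr (\<rho> 0 1) = c.tr \<sigma>"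
    using \<rho>_invertible_normalized[OF one_mem_Z_0] by (auto simp: Tr_eq[OF one_mem_Z_0])
  then have "dim_beta \<beta> 0 1 = real (d 0 1)"
    using c.tr_wpow_scalar_weight[OF k, of \<sigma> "- \<beta>"]
    by (simp add: dim_beta_def Tr_eq[OF one_mem_Z_0] rho_power_eq[OF one_mem_Z_0])
  then show ?thesis using d_pos[OF one_mem_Z_0] by (simp add: ratio_def)
qed

section \<open>The affine isomorphism and its inverse\<close>

definition weight_extension :: "real \<Rightarrow> (nat \<times> 'a \<Rightarrow> real) \<Rightarrow> (nat \<times> 'a) \<times> real \<Rightarrow> real" where
  "weight_extension \<beta> \<nu> = (\<lambda>((n, z), \<gamma>)\<in>ZZ \<times> \<Gamma>. ratio \<beta> n z * \<nu> (n, z) * \<gamma> powr \<beta>)"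

text \<open>Evaluation at weight 1 loses nothing, since the scaling condition recovers all other
  weights.\<close>

definition weight_contraction :: "real \<Rightarrow> ((nat \<times> 'a) \<times> real \<Rightarrow> real) \<Rightarrow> nat \<times> 'a \<Rightarrow> real" where
  "weight_contraction \<beta> \<nu> = (\<lambda>(n, z)\<in>ZZ. \<nu> ((n, z), 1) / ratio \<beta> n z)"

lemma weight_extension_apply: "\<lbrakk>z \<in> Z n; \<gamma> \<in> \<Gamma>\<rbrakk> \<Longrightarrow> weight_extension \<beta> \<nu> ((n, z), \<gamma>) = ratio \<beta> n z * \<nu> (n, z) * \<gamma> powr \<beta>"
  by (simp add: weight_extension_def ZZ_def)

lemma weight_contraction_apply: "z \<in> Z n \<Longrightarrow> weight_contraction \<beta> \<nu> (n, z) = \<nu> ((n, z), 1) / ratio \<beta> n z"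
  by (simp add: weight_contraction_def ZZ_def)

text \<open>Stated for every nonnegative function, so that it serves both directions: applied to a
  contraction, whose extension is the given harmonic function, it also yields harmonicity of the
  contraction.\<close>

lemma weight_extension_harmonic_iff:
  assumes "\<nu> \<in> ZZ \<rightarrow>\<^sub>E {0..}"
  shows "weight_extension \<beta> \<nu> \<in> harmonic_mu \<beta> \<longleftrightarrow> \<nu> \<in> harmonic_kappa \<beta>"
proof -
  have nonneg: "\<nu> (n, z) \<ge> 0" if "z \<in> Z n" for n z
    using assms that by (auto simp: ZZ_def)
  have ext: "weight_extension \<beta> \<nu> \<in> ZZ \<times> \<Gamma> \<rightarrow>\<^sub>E {0..}"
    using nonneg ratio_pos by (auto simp: weight_extension_def ZZ_def less_imp_le)
  have step: "((\<lambda>(z, \<gamma>). weight_extension \<beta> \<nu> ((Suc n, z), \<gamma>) * mu n (z, \<gamma>) (z', \<gamma>')) has_sum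
        weight_extension \<beta> \<nu> ((n, z'), \<gamma>')) (Z (Suc n) \<times> \<Gamma>) \<longleftrightarrow>
      ((\<lambda>z. \<nu> (Suc n, z) * kappa \<beta> n z z') has_sum \<nu> (n, z')) (Z (Suc n))"
    if z': "z' \<in> Z n" and \<gamma>': "\<gamma>' \<in> \<Gamma>" for n z' \<gamma>'
  proof -
    have "((\<lambda>(z, \<gamma>). weight_extension \<beta> \<nu> ((Suc n, z), \<gamma>) * mu n (z, \<gamma>) (z', \<gamma>')) has_sum
        weight_extension \<beta> \<nu> ((n, z'), \<gamma>')) (Z (Suc n) \<times> \<Gamma>) \<longleftrightarrow>
      ((\<lambda>(z, \<gamma>). (ratio \<beta> (Suc n) z * \<nu> (Suc n, z) * \<gamma> powr \<beta>) * mu n (z, \<gamma>) (z', \<gamma>')) has_sum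
        ratio \<beta> n z' * \<nu> (n, z') * \<gamma>' powr \<beta>) (Z (Suc n) \<times> \<Gamma>)"
      unfolding weight_extension_apply[OF z' \<gamma>'] by (rule has_sum_cong) (auto simp: weight_extension_apply)
    also have "\<dots> \<longleftrightarrow> ((\<lambda>z. \<nu> (Suc n, z) * kappa \<beta> n z z') has_sum \<nu> (n, z')) (Z (Suc n))"
      by (rule harmonic_iff[OF z' \<gamma>']) (rule nonneg)
    finally show ?thesis .
  qed
  have scaling: "weight_extension \<beta> \<nu> ((n, z), \<gamma>) = \<gamma> powr \<beta> * weight_extension \<beta> \<nu> ((n, z), 1)"
    if "z \<in> Z n" "\<gamma> \<in> \<Gamma>" for n z \<gamma>
    using that by (simp add: weight_extension_apply \<Gamma>_one)
  have root: "weight_extension \<beta> \<nu> ((0, 1), 1) = \<nu> (0, 1)"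
    by (simp add: weight_extension_apply one_mem_Z_0 \<Gamma>_one ratio_0)
  have "weight_extension \<beta> \<nu> \<in> harmonic_mu \<beta> \<longleftrightarrow>
      (\<forall>n. \<forall>z'\<in>Z n. \<forall>\<gamma>'\<in>\<Gamma>. ((\<lambda>(z, \<gamma>). weight_extension \<beta> \<nu> ((Suc n, z), \<gamma>) * mu n (z, \<gamma>) (z', \<gamma>')) has_sum
        weight_extension \<beta> \<nu> ((n, z'), \<gamma>')) (Z (Suc n) \<times> \<Gamma>)) \<and> \<nu> (0, 1) = 1"
    unfolding harmonic_mu_def mem_Collect_eq root using ext scaling by blast
  also have "\<dots> \<longleftrightarrow> (\<forall>n. \<forall>z'\<in>Z n.
      ((\<lambda>z. \<nu> (Suc n, z) * kappa \<beta> n z z') has_sum \<nu> (n, z')) (Z (Suc n))) \<and> \<nu> (0, 1) = 1"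
    \<comment> \<open>Recovering \<kappa>-harmonicity takes one instance of the equations indexed by
      \<gamma>', and 1 supplies it.\<close>
    using step \<Gamma>_one by blast
  finally show ?thesis
    unfolding harmonic_kappa_def mem_Collect_eq using assms by blast
qed

lemma weight_contraction_extension:
  assumes "\<nu> \<in> harmonic_kappa \<beta>"
  shows "weight_contraction \<beta> (weight_extension \<beta> \<nu>) = \<nu>"
proof (rule extensionalityI[of _ ZZ])
  show "\<nu> \<in> extensional ZZ" using assms by (auto simp: harmonic_kappa_def PiE_def)
  fix x assume "x \<in> ZZ"
  then obtain n z where x: "x = (n, z)" "z \<in> Z n" by (auto simp: ZZ_def)
  then show "weight_contraction \<beta> (weight_extension \<beta> \<nu>) x = \<nu> x"
    using ratio_pos[of z n \<beta>] by (simp add: weight_contraction_apply weight_extension_apply \<Gamma>_one)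
qed (simp add: weight_contraction_def)

lemma weight_extension_contraction:
  assumes "\<nu> \<in> harmonic_mu \<beta>"
  shows "weight_extension \<beta> (weight_contraction \<beta> \<nu>) = \<nu>"
proof (rule extensionalityI[of _ "ZZ \<times> \<Gamma>"])
  show "\<nu> \<in> extensional (ZZ \<times> \<Gamma>)" using assms by (auto simp: harmonic_mu_def PiE_def)
  fix x assume "x \<in> ZZ \<times> \<Gamma>"
  then obtain n z \<gamma> where x: "x = ((n, z), \<gamma>)" "z \<in> Z n" "\<gamma> \<in> \<Gamma>" by (auto simp: ZZ_def)
  then have "\<nu> ((n, z), \<gamma>) = \<gamma> powr \<beta> * \<nu> ((n, z), 1)"
    using assms by (auto simp: harmonic_mu_def)
  then show "weight_extension \<beta> (weight_contraction \<beta> \<nu>) x = \<nu> x"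
    using x ratio_pos[of z n \<beta>] by (simp add: weight_contraction_apply weight_extension_apply)
qed (simp add: weight_extension_def)

lemma weight_contraction_harmonic:
  assumes "\<nu> \<in> harmonic_mu \<beta>"
  shows "weight_contraction \<beta> \<nu> \<in> harmonic_kappa \<beta>"
proof -
  have "\<nu> \<in> ZZ \<times> \<Gamma> \<rightarrow>\<^sub>E {0..}" using assms by (simp add: harmonic_mu_def)
  from PiE_mem[OF this] have "\<nu> ((n, z), 1) \<ge> 0" if "z \<in> Z n" for n z
    using that \<Gamma>_one by (simp add: ZZ_def)
  then have "weight_contraction \<beta> \<nu> \<in> ZZ \<rightarrow>\<^sub>E {0..}"
    using ratio_pos by (auto simp: weight_contraction_def ZZ_def less_imp_le)
  then show ?thesis
    using assms weight_extension_harmonic_iff[of "weight_contraction \<beta> \<nu>" \<beta>] weight_extension_contraction[OF assms] by simp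
qed

lemma bij_betw_weight_extension: "bij_betw (weight_extension \<beta>) (harmonic_kappa \<beta>) (harmonic_mu \<beta>)"
proof (rule bij_betw_byWitness[where f' = "weight_contraction \<beta>"])
  show "weight_extension \<beta> ` harmonic_kappa \<beta> \<subseteq> harmonic_mu \<beta>"
    using weight_extension_harmonic_iff by (auto simp: harmonic_kappa_def)
qed (auto simp: weight_contraction_extension weight_extension_contraction weight_contraction_harmonic)

text \<open>Off the domain the identity persists because t u + (1 - t) u = u for the value u =
  \<open>undefined\<close>.\<close>

lemma weight_extension_convex_comb:
  "weight_extension \<beta> (convex_comb t f g) = convex_comb t (weight_extension \<beta> f) (weight_extension \<beta> g)"
  by (rule ext) (auto simp: weight_extension_def convex_comb_def restrict_def algebra_simps)

lemma convex_harmonic_kappa: "convex_funs (harmonic_kappa \<beta>)"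
  unfolding convex_funs_def
proof (intro ballI)
  fix f g and t :: real
  assume f: "f \<in> harmonic_kappa \<beta>" and g: "g \<in> harmonic_kappa \<beta>" and t: "t \<in> {0..1}"
  have "convex_comb t f g \<in> ZZ \<rightarrow>\<^sub>E {0..}"
  proof (rule PiE_I)
    fix x assume "x \<in> ZZ"
    then have "f x \<ge> 0" "g x \<ge> 0" using f g by (auto simp: harmonic_kappa_def)
    then show "convex_comb t f g x \<in> {0..}" using t by (simp add: convex_comb_def)
  next
    fix x assume "x \<notin> ZZ"
    then have "f x = undefined" "g x = undefined"
      using f g unfolding harmonic_kappa_def by (blast intro: PiE_arb)+
    then show "convex_comb t f g x = undefined" by (simp add: convex_comb_def algebra_simps)
  qed
  moreover have "((\<lambda>z. convex_comb t f g (Suc n, z) * kappa \<beta> n z z') has_sum convex_comb t f g (n, z')) (Z (Suc n))"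
    if "z' \<in> Z n" for n z'
  proof -
    have "((\<lambda>z. t * (f (Suc n, z) * kappa \<beta> n z z') + (1 - t) * (g (Suc n, z) * kappa \<beta> n z z')) has_sum
        t * f (n, z') + (1 - t) * g (n, z')) (Z (Suc n))"
      using f g that by (intro has_sum_add has_sum_cmult_right) (auto simp: harmonic_kappa_def)
    then show ?thesis by (simp add: convex_comb_def algebra_simps)
  qed
  ultimately show "convex_comb t f g \<in> harmonic_kappa \<beta>"
    using f g by (simp add: harmonic_kappa_def convex_comb_def)
qed

text \<open>Convexity of the target is inherited: it is the image of a convex set under a map that
  respects convex combinations.\<close>

lemma affine_isomorphism_weight_extension: "affine_isomorphism (harmonic_kappa \<beta>) (harmonic_mu \<beta>) (weight_extension \<beta>)"
proof -
  have image: "weight_extension \<beta> ` harmonic_kappa \<beta> = harmonic_mu \<beta>"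
    using bij_betw_weight_extension by (rule bij_betw_imp_surj_on)
  have "convex_funs (harmonic_mu \<beta>)"
    using convex_harmonic_kappa[of \<beta>]
    by (auto simp: convex_funs_def simp flip: image weight_extension_convex_comb)
  then show ?thesis
    by (simp add: affine_isomorphism_def convex_harmonic_kappa bij_betw_weight_extension weight_extension_convex_comb)
qed

text \<open>Positivity of \<open>dim_beta\<close> allows solving the defining relation for the value
  at each vertex. This gives both the formula and the uniqueness.\<close>

lemma dim_beta_mult_eq_iff:
  assumes "z \<in> Z n" "\<gamma> \<in> \<Gamma>"
  shows "dim_beta \<beta> n z * y = real (d n z) * \<nu> (n, z) * \<gamma> powr \<beta> \<longleftrightarrow> y = weight_extension \<beta> \<nu> ((n, z), \<gamma>)"
  using dim_beta_pos[OF assms(1), of \<beta>] by (auto simp: weight_extension_apply[OF assms] ratio_def field_simps)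

end

theorem theorem4p7:
  fixes A :: "nat \<Rightarrow> 'a::cstar_algebra set"
    and d :: "nat \<Rightarrow> 'a \<Rightarrow> nat"
    and \<pi> :: "nat \<Rightarrow> 'a \<Rightarrow> 'a \<Rightarrow> complex mat"
    and \<rho> :: "nat \<Rightarrow> 'a \<Rightarrow> 'a"
    and P :: "nat \<Rightarrow> ('a \<Rightarrow> complex) set"
    and \<alpha> :: "real \<Rightarrow> 'a \<Rightarrow> 'a"
    and \<beta> :: real
  assumes "flow_on_tower A d \<pi> \<rho> P \<alpha>"
  shows "\<exists>!F. F \<in> extensional (weighted_tower.harmonic_kappa A \<pi> \<rho> \<beta>) \<and>
     affine_isomorphism (weighted_tower.harmonic_kappa A \<pi> \<rho> \<beta>)
       (weighted_tower.harmonic_mu A d \<pi> \<rho> \<beta>) F \<and>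
     (\<forall>\<nu>\<in>weighted_tower.harmonic_kappa A \<pi> \<rho> \<beta>. \<forall>n. \<forall>z\<in>weighted_tower.Z A n.
        \<forall>\<gamma>\<in>weighted_tower.\<Gamma> A \<pi> \<rho>.
          weighted_tower.dim_beta A \<pi> \<rho> \<beta> n z * F \<nu> ((n, z), \<gamma>) =
          real (d n z) * \<nu> (n, z) * \<gamma> powr \<beta>)"
proof -
  interpret flow_on_tower A d \<pi> \<rho> P \<alpha> by fact
  let ?K = "harmonic_kappa \<beta>" and ?M = "harmonic_mu \<beta>"
  \<comment> \<open>Restricting to the domain fixes the values elsewhere, so that uniqueness can
    hold as equality of functions.\<close>
  let ?F = "restrict (weight_extension \<beta>) ?K"
  show ?thesis
  proof (rule ex1I[of _ ?F], intro conjI)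
    have "bij_betw ?F ?K ?M"
      using bij_betw_weight_extension by (subst bij_betw_restrict_eq)
    then show "affine_isomorphism ?K ?M ?F"
      using affine_isomorphism_weight_extension[of \<beta>] by (auto simp: affine_isomorphism_def convex_funs_def)
    show "\<forall>\<nu>\<in>?K. \<forall>n. \<forall>z\<in>Z n. \<forall>\<gamma>\<in>\<Gamma>.
        dim_beta \<beta> n z * ?F \<nu> ((n, z), \<gamma>) = real (d n z) * \<nu> (n, z) * \<gamma> powr \<beta>"
      by (simp add: dim_beta_mult_eq_iff)
  next
    fix F
    assume F: "F \<in> extensional ?K \<and> affine_isomorphism ?K ?M F \<and>
      (\<forall>\<nu>\<in>?K. \<forall>n. \<forall>z\<in>Z n. \<forall>\<gamma>\<in>\<Gamma>.
        dim_beta \<beta> n z * F \<nu> ((n, z), \<gamma>) = real (d n z) * \<nu> (n, z) * \<gamma> powr \<beta>)"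
    show "F = ?F"
    proof (rule extensionalityI[of _ ?K])
      fix \<nu> assume \<nu>: "\<nu> \<in> ?K"
      \<comment> \<open>Membership in the target fixes \<open>F \<nu>\<close> to be
        \<open>undefined\<close> off the extended vertex set; on that set the relation determines
        it.\<close>
      have "F \<nu> \<in> ?M" using F \<nu> by (auto simp: affine_isomorphism_def bij_betw_def)
      then have ext: "F \<nu> \<in> extensional (ZZ \<times> \<Gamma>)" by (auto simp: harmonic_mu_def PiE_def)
      have "F \<nu> = weight_extension \<beta> \<nu>"
        using ext F \<nu> by (intro extensionalityI[of _ "ZZ \<times> \<Gamma>"]) (auto simp: weight_extension_def dim_beta_mult_eq_iff ZZ_def weight_extension_apply)
      then show "F \<nu> = ?F \<nu>" using \<nu> by simp
    qed (use F in auto)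
  qed simp
qed

end
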